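(* Let $k$ be an algebraically closed field of characteristic zero. Let $m \in \mathbb{N}$ and let $n \geq 2$ be an integer such that $n \geq 2m$. Then there exists a surjective morphism of $\mathbb{N}$-graded Lie algebras over $k$ from the Yang-Mills algebra $\mathfrak{ym}(n)$ on $n$ generators to $\mathfrak{f}(m)$, the free Lie algebra over $k$ on $m$ generators.
   Context: For an integer $n \geq 2$, let $\mathfrak{f}(x_1,\dots,x_n)$ be the free Lie algebra over $k$ on generators $x_1,\dots,x_n$. The Yang-Mills algebra on $n$ generators is the quotient Lie algebra $$\mathfrak{ym}(n) = \mathfrak{f}(x_1,\dots,x_n)\big/\big\langle \textstyle\sum_{i=1}^n [x_i,[x_i,x_j]] : 1 \leq j \leq n \big\rangle,$$ where $\langle\,\cdot\,\rangle$ denotes the Lie ideal generated by the given elements. Free Lie algebras carry the $\mathbb{N}$-grading in which each free generator has degree $1$; since the relations defining $\mathfrak{ym}(n)$ are homogeneous of degree $3$, $\mathfrak{ym}(n)$ inherits an $\mathbb{N}$-grading. A morphism of graded Lie algebras is a Lie algebra morphism preserving degrees. *)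

theory Defs
  imports "HOL-Algebra.Algebraic_Closure" "HOL-Algebra.QuotRing" "HOL-Algebra.Module"
begin

section \<open>Graded algebras and graded Lie algebras\<close>

text \<open>
  As for \<^locale>\<open>module\<close>, the field \<open>one\<close> of the record plays no role. The field
  \<open>mult\<close> is the product, which for a Lie algebra is the bracket: \<open>x \<otimes> y\<close> stands for \<open>[x, y]\<close>.
\<close>

record ('k, 'a) graded_algebra = "('k, 'a) module" +
  gr :: "nat \<Rightarrow> 'a set"

locale nonassoc_algebra = module K A for K (structure) and A (structure) +
  assumes prod_closed [simp, intro]:
      "\<lbrakk>x \<in> carrier A; y \<in> carrier A\<rbrakk> \<Longrightarrow> x \<otimes>\<^bsub>A\<^esub> y \<in> carrier A"
    and prod_add_left:
      "\<lbrakk>x \<in> carrier A; y \<in> carrier A; z \<in> carrier A\<rbrakk> \<Longrightarrow>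
        (x \<oplus>\<^bsub>A\<^esub> y) \<otimes>\<^bsub>A\<^esub> z = x \<otimes>\<^bsub>A\<^esub> z \<oplus>\<^bsub>A\<^esub> y \<otimes>\<^bsub>A\<^esub> z"
    and prod_add_right:
      "\<lbrakk>x \<in> carrier A; y \<in> carrier A; z \<in> carrier A\<rbrakk> \<Longrightarrow>
        z \<otimes>\<^bsub>A\<^esub> (x \<oplus>\<^bsub>A\<^esub> y) = z \<otimes>\<^bsub>A\<^esub> x \<oplus>\<^bsub>A\<^esub> z \<otimes>\<^bsub>A\<^esub> y"
    and prod_smult_left:
      "\<lbrakk>a \<in> carrier K; x \<in> carrier A; y \<in> carrier A\<rbrakk> \<Longrightarrow>
        (a \<odot>\<^bsub>A\<^esub> x) \<otimes>\<^bsub>A\<^esub> y = a \<odot>\<^bsub>A\<^esub> (x \<otimes>\<^bsub>A\<^esub> y)"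
    and prod_smult_right:
      "\<lbrakk>a \<in> carrier K; x \<in> carrier A; y \<in> carrier A\<rbrakk> \<Longrightarrow>
        x \<otimes>\<^bsub>A\<^esub> (a \<odot>\<^bsub>A\<^esub> y) = a \<odot>\<^bsub>A\<^esub> (x \<otimes>\<^bsub>A\<^esub> y)"

locale lie_algebra = nonassoc_algebra K L + field K for K (structure) and L (structure) +
  assumes alternating: "x \<in> carrier L \<Longrightarrow> x \<otimes>\<^bsub>L\<^esub> x = \<zero>\<^bsub>L\<^esub>"
    and jacobi: "\<lbrakk>x \<in> carrier L; y \<in> carrier L; z \<in> carrier L\<rbrakk> \<Longrightarrow>
        x \<otimes>\<^bsub>L\<^esub> (y \<otimes>\<^bsub>L\<^esub> z) \<oplus>\<^bsub>L\<^esub> y \<otimes>\<^bsub>L\<^esub> (z \<otimes>\<^bsub>L\<^esub> x)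
          \<oplus>\<^bsub>L\<^esub> z \<otimes>\<^bsub>L\<^esub> (x \<otimes>\<^bsub>L\<^esub> y) = \<zero>\<^bsub>L\<^esub>"

text \<open>The second assumption says that the algebra is the direct sum of its graded pieces.\<close>

locale graded_nonassoc_algebra = nonassoc_algebra K A
  for K (structure) and A :: "('k, 'a, 'm) graded_algebra_scheme" (structure) +
  assumes gr_submodule: "submodule (gr A d) K A"
    and gr_decomp: "x \<in> carrier A \<Longrightarrow>
        \<exists>!c. (\<forall>d. c d \<in> gr A d) \<and> finite {d. c d \<noteq> \<zero>\<^bsub>A\<^esub>}
          \<and> x = (\<Oplus>\<^bsub>A\<^esub>d\<in>{d. c d \<noteq> \<zero>\<^bsub>A\<^esub>}. c d)"
    and gr_prod: "\<lbrakk>x \<in> gr A d; y \<in> gr A e\<rbrakk> \<Longrightarrow> x \<otimes>\<^bsub>A\<^esub> y \<in> gr A (d + e)"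

locale graded_lie_algebra = lie_algebra K L + graded_nonassoc_algebra K L
  for K (structure) and L :: "('k, 'a, 'm) graded_algebra_scheme" (structure)

locale graded_lie_hom = L?: graded_lie_algebra K L + M?: graded_lie_algebra K M
  for K (structure) and L :: "('k, 'a, 'm) graded_algebra_scheme" (structure)
    and M :: "('k, 'b, 'p) graded_algebra_scheme" (structure) +
  fixes \<phi>
  assumes hom_closed: "x \<in> carrier L \<Longrightarrow> \<phi> x \<in> carrier M"
    and hom_add: "\<lbrakk>x \<in> carrier L; y \<in> carrier L\<rbrakk> \<Longrightarrow> \<phi> (x \<oplus>\<^bsub>L\<^esub> y) = \<phi> x \<oplus>\<^bsub>M\<^esub> \<phi> y"
    and hom_smult: "\<lbrakk>a \<in> carrier K; x \<in> carrier L\<rbrakk> \<Longrightarrow> \<phi> (a \<odot>\<^bsub>L\<^esub> x) = a \<odot>\<^bsub>M\<^esub> \<phi> x"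
    and hom_bracket: "\<lbrakk>x \<in> carrier L; y \<in> carrier L\<rbrakk> \<Longrightarrow> \<phi> (x \<otimes>\<^bsub>L\<^esub> y) = \<phi> x \<otimes>\<^bsub>M\<^esub> \<phi> y"
    and hom_gr: "x \<in> gr L d \<Longrightarrow> \<phi> x \<in> gr M d"


section \<open>Ideals and quotients\<close>

text \<open>
  Two-sided ideals. In a Lie algebra these are the Lie ideals, because \<open>[x, y] = - [y, x]\<close>.
\<close>

definition algebra_ideal :: "_ \<Rightarrow> _ \<Rightarrow> 'a set \<Rightarrow> bool" where
  "algebra_ideal K A I \<longleftrightarrow> submodule I K A \<and>
     (\<forall>x\<in>carrier A. \<forall>y\<in>I. x \<otimes>\<^bsub>A\<^esub> y \<in> I \<and> y \<otimes>\<^bsub>A\<^esub> x \<in> I)"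

definition ideal_span :: "_ \<Rightarrow> _ \<Rightarrow> 'a set \<Rightarrow> 'a set" where
  "ideal_span K A S = \<Inter>{I. algebra_ideal K A I \<and> S \<subseteq> I}"

definition quot_algebra ::
    "('k, 'a, 'm) graded_algebra_scheme \<Rightarrow> 'a set \<Rightarrow> ('k, 'a set) graded_algebra" where
  "quot_algebra A I =
    \<lparr>carrier = a_rcosets\<^bsub>A\<^esub> I,
     monoid.mult = rcoset_mult A I,
     one = I +>\<^bsub>A\<^esub> \<one>\<^bsub>A\<^esub>,
     ring.zero = I,
     add = set_add A,
     smult = (\<lambda>a S. \<Union>x\<in>S. I +>\<^bsub>A\<^esub> (a \<odot>\<^bsub>A\<^esub> x)),
     gr = (\<lambda>d. (\<lambda>x. I +>\<^bsub>A\<^esub> x) ` gr A d)\<rparr>"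


section \<open>The free Lie algebra on a set\<close>

text \<open>
  The free Lie algebra is the quotient of the free nonassociative algebra, that is, of the algebra
  of the free magma, by the ideal generated by all \<open>x x\<close> and all Jacobi sums. An element of the free
  nonassociative algebra is the finitely supported function of its coefficients. The coefficient of
  a tree \<open>Br s t\<close> in a product \<open>f g\<close> is the product of the coefficient of \<open>s\<close> in \<open>f\<close> and of \<open>t\<close> in
  \<open>g\<close>, as \<open>Br s t\<close> is a product of two trees in only one way.
\<close>

datatype 'x free_magma = Gen 'x | Br "'x free_magma" "'x free_magma"

primrec leaves :: "'x free_magma \<Rightarrow> nat" where
  "leaves (Gen x) = 1"
| "leaves (Br s t) = leaves s + leaves t"

definition free_nonassoc_carrier :: "('k, 'r) ring_scheme \<Rightarrow> 'x set \<Rightarrow> ('x free_magma \<Rightarrow> 'k) set" where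
  "free_nonassoc_carrier K S = {f. (\<forall>t. f t \<in> carrier K) \<and> finite {t. f t \<noteq> \<zero>\<^bsub>K\<^esub>}
     \<and> (\<forall>t. f t \<noteq> \<zero>\<^bsub>K\<^esub> \<longrightarrow> set_free_magma t \<subseteq> S)}"

definition free_nonassoc ::
    "('k, 'r) ring_scheme \<Rightarrow> 'x set \<Rightarrow> ('k, 'x free_magma \<Rightarrow> 'k) graded_algebra" where
  "free_nonassoc K S =
    \<lparr>carrier = free_nonassoc_carrier K S,
     monoid.mult = (\<lambda>f g t. case t of Gen x \<Rightarrow> \<zero>\<^bsub>K\<^esub> | Br s u \<Rightarrow> f s \<otimes>\<^bsub>K\<^esub> g u),
     one = (\<lambda>t. \<zero>\<^bsub>K\<^esub>),
     ring.zero = (\<lambda>t. \<zero>\<^bsub>K\<^esub>),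
     add = (\<lambda>f g t. f t \<oplus>\<^bsub>K\<^esub> g t),
     smult = (\<lambda>a f t. a \<otimes>\<^bsub>K\<^esub> f t),
     gr = (\<lambda>d. {f \<in> free_nonassoc_carrier K S. \<forall>t. f t \<noteq> \<zero>\<^bsub>K\<^esub> \<longrightarrow> leaves t = d})\<rparr>"

definition lie_relators :: "_ \<Rightarrow> 'a set" where
  "lie_relators A =
     {x \<otimes>\<^bsub>A\<^esub> x | x. x \<in> carrier A} \<union>
     {x \<otimes>\<^bsub>A\<^esub> (y \<otimes>\<^bsub>A\<^esub> z) \<oplus>\<^bsub>A\<^esub> y \<otimes>\<^bsub>A\<^esub> (z \<otimes>\<^bsub>A\<^esub> x) \<oplus>\<^bsub>A\<^esub> z \<otimes>\<^bsub>A\<^esub> (x \<otimes>\<^bsub>A\<^esub> y)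
        | x y z. x \<in> carrier A \<and> y \<in> carrier A \<and> z \<in> carrier A}"

definition lie_relation_ideal :: "('k, 'r) ring_scheme \<Rightarrow> 'x set \<Rightarrow> ('x free_magma \<Rightarrow> 'k) set" where
  "lie_relation_ideal K S = ideal_span K (free_nonassoc K S) (lie_relators (free_nonassoc K S))"

definition free_lie ::
    "('k, 'r) ring_scheme \<Rightarrow> 'x set \<Rightarrow> ('k, ('x free_magma \<Rightarrow> 'k) set) graded_algebra" where
  "free_lie K S = quot_algebra (free_nonassoc K S) (lie_relation_ideal K S)"

definition lie_gen :: "('k, 'r) ring_scheme \<Rightarrow> 'x set \<Rightarrow> 'x \<Rightarrow> ('x free_magma \<Rightarrow> 'k) set" where
  "lie_gen K S i =
     lie_relation_ideal K S +>\<^bsub>free_nonassoc K S\<^esub> (\<lambda>t. if t = Gen i then \<one>\<^bsub>K\<^esub> else \<zero>\<^bsub>K\<^esub>)"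


section \<open>The Yang-Mills algebra\<close>

definition yang_mills_relator ::
    "('k, 'r) ring_scheme \<Rightarrow> nat \<Rightarrow> nat \<Rightarrow> (nat free_magma \<Rightarrow> 'k) set" where
  "yang_mills_relator K n j =
     (\<Oplus>\<^bsub>free_lie K {1..n}\<^esub>i\<in>{1..n}.
        lie_gen K {1..n} i \<otimes>\<^bsub>free_lie K {1..n}\<^esub>
          (lie_gen K {1..n} i \<otimes>\<^bsub>free_lie K {1..n}\<^esub> lie_gen K {1..n} j))"

definition yang_mills ::
    "('k, 'r) ring_scheme \<Rightarrow> nat \<Rightarrow> ('k, (nat free_magma \<Rightarrow> 'k) set set) graded_algebra" where
  "yang_mills K n =
     quot_algebra (free_lie K {1..n})
       (ideal_span K (free_lie K {1..n}) (yang_mills_relator K n ` {1..n}))"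


section \<open>The free Lie algebra and the Yang-Mills algebra are graded Lie algebras\<close>

subsection \<open>Quotients of nonassociative algebras\<close>

context nonassoc_algebra
begin

lemma algebra_ideal_carrier: "algebra_ideal K A (carrier A)"
  unfolding algebra_ideal_def using carrier_is_submodule by auto

lemma algebra_idealI:
  assumes "I \<subseteq> carrier A" "\<zero>\<^bsub>A\<^esub> \<in> I"
    and "\<And>x y. \<lbrakk>x \<in> I; y \<in> I\<rbrakk> \<Longrightarrow> x \<oplus>\<^bsub>A\<^esub> y \<in> I"
    and smult: "\<And>a x. \<lbrakk>a \<in> carrier K; x \<in> I\<rbrakk> \<Longrightarrow> a \<odot>\<^bsub>A\<^esub> x \<in> I"
    and "\<And>x y. \<lbrakk>x \<in> carrier A; y \<in> I\<rbrakk> \<Longrightarrow> x \<otimes>\<^bsub>A\<^esub> y \<in> I"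
    and "\<And>x y. \<lbrakk>x \<in> carrier A; y \<in> I\<rbrakk> \<Longrightarrow> y \<otimes>\<^bsub>A\<^esub> x \<in> I"
  shows "algebra_ideal K A I"
proof -
  have "\<ominus>\<^bsub>A\<^esub> x \<in> I" if "x \<in> I" for x
  proof -
    have "x \<in> carrier A" using that assms(1) by auto
    hence "\<ominus>\<^bsub>A\<^esub> x = (\<ominus>\<^bsub>K\<^esub> \<one>\<^bsub>K\<^esub>) \<odot>\<^bsub>A\<^esub> x" by (simp add: smult_l_minus)
    thus ?thesis using smult that by simp
  qed
  thus ?thesis unfolding algebra_ideal_def using assms by (auto intro!: submoduleI)
qed

lemma algebra_idealD:
  assumes "algebra_ideal K A I"
  shows "I \<subseteq> carrier A" "\<zero>\<^bsub>A\<^esub> \<in> I"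
    and "\<And>x y. \<lbrakk>x \<in> I; y \<in> I\<rbrakk> \<Longrightarrow> x \<oplus>\<^bsub>A\<^esub> y \<in> I"
    and "\<And>x. x \<in> I \<Longrightarrow> \<ominus>\<^bsub>A\<^esub> x \<in> I"
    and "\<And>a x. \<lbrakk>a \<in> carrier K; x \<in> I\<rbrakk> \<Longrightarrow> a \<odot>\<^bsub>A\<^esub> x \<in> I"
    and "\<And>x y. \<lbrakk>x \<in> carrier A; y \<in> I\<rbrakk> \<Longrightarrow> x \<otimes>\<^bsub>A\<^esub> y \<in> I"
    and "\<And>x y. \<lbrakk>x \<in> carrier A; y \<in> I\<rbrakk> \<Longrightarrow> y \<otimes>\<^bsub>A\<^esub> x \<in> I"
proof -
  have sm: "submodule I K A" using assms unfolding algebra_ideal_def by auto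
  show "I \<subseteq> carrier A" using submoduleE(1)[OF sm] .
  show "\<zero>\<^bsub>A\<^esub> \<in> I" using subgroup.one_closed[OF submodule.axioms(1)[OF sm]] by simp
  show "\<And>x. x \<in> I \<Longrightarrow> \<ominus>\<^bsub>A\<^esub> x \<in> I" "\<And>x y. \<lbrakk>x \<in> I; y \<in> I\<rbrakk> \<Longrightarrow> x \<oplus>\<^bsub>A\<^esub> y \<in> I"
    "\<And>a x. \<lbrakk>a \<in> carrier K; x \<in> I\<rbrakk> \<Longrightarrow> a \<odot>\<^bsub>A\<^esub> x \<in> I"
    using submoduleE(3-5)[OF sm] by blast+
qed (use assms in \<open>auto simp: algebra_ideal_def\<close>)

lemma ideal_span_ideal:
  assumes "S \<subseteq> carrier A"
  shows "algebra_ideal K A (ideal_span K A S)"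
proof (rule algebra_idealI)
  show "ideal_span K A S \<subseteq> carrier A"
    unfolding ideal_span_def using algebra_ideal_carrier assms by blast
qed (auto simp: ideal_span_def dest: algebra_idealD)

lemma ideal_span_superset: "S \<subseteq> ideal_span K A S"
  unfolding ideal_span_def by auto

lemma ideal_span_minimal: "algebra_ideal K A I \<Longrightarrow> S \<subseteq> I \<Longrightarrow> ideal_span K A S \<subseteq> I"
  unfolding ideal_span_def by auto

end

locale algebra_quotient = nonassoc_algebra K A
  for K (structure) and A :: "('k, 'a, 'm) graded_algebra_scheme" (structure) +
  fixes I
  assumes I_ideal: "algebra_ideal K A I"
begin

sublocale sub: abelian_subgroup I A
proof (rule abelian_subgroupI3)
  show "additive_subgroup I A"
    using I_ideal unfolding algebra_ideal_def
    by (auto intro: additive_subgroup.intro submodule.axioms(1))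
qed (rule abelian_group_axioms)

abbreviation cls :: "'a \<Rightarrow> 'a set" where "cls x \<equiv> I +>\<^bsub>A\<^esub> x"

lemmas I_closed = algebra_idealD[OF I_ideal]

lemma I_carrier: "x \<in> I \<Longrightarrow> x \<in> carrier A" using I_closed(1) by auto

lemma cls_eq_iff:
  assumes "x \<in> carrier A" "y \<in> carrier A"
  shows "cls x = cls y \<longleftrightarrow> x \<ominus>\<^bsub>A\<^esub> y \<in> I"
proof
  assume "cls x = cls y"
  hence "x \<in> cls y" using sub.a_rcos_self[OF assms(1)] by simp
  then obtain h where h: "h \<in> I" "x = h \<oplus>\<^bsub>A\<^esub> y" by (auto simp: a_r_coset_def')
  hence "x \<ominus>\<^bsub>A\<^esub> y = h" using assms I_carrier[OF h(1)]
    by (simp add: a_minus_def M.a_assoc M.r_neg)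
  thus "x \<ominus>\<^bsub>A\<^esub> y \<in> I" using h by simp
next
  assume h: "x \<ominus>\<^bsub>A\<^esub> y \<in> I"
  have "(x \<ominus>\<^bsub>A\<^esub> y) \<oplus>\<^bsub>A\<^esub> y = x" using assms
    by (simp add: a_minus_def M.a_assoc M.l_neg)
  hence "x \<in> cls y" using h unfolding a_r_coset_def' by blast
  thus "cls x = cls y" using a_repr_independence[OF _ assms(2) sub.a_subgroup] by simp
qed

lemma cls_eqI:
  assumes "x \<in> carrier A" "y \<in> carrier A" "h \<in> I" "x = h \<oplus>\<^bsub>A\<^esub> y"
  shows "cls x = cls y"
proof -
  have "x \<in> cls y" using assms(3,4) by (auto simp: a_r_coset_def')
  thus ?thesis using a_repr_independence[OF _ assms(2) sub.a_subgroup] by simp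
qed

lemma cls_memE:
  assumes "z \<in> cls x"
  obtains h where "h \<in> I" "z = h \<oplus>\<^bsub>A\<^esub> x"
  using assms by (auto simp: a_r_coset_def')

lemma cls_add: "\<lbrakk>x \<in> carrier A; y \<in> carrier A\<rbrakk> \<Longrightarrow> set_add A (cls x) (cls y) = cls (x \<oplus>\<^bsub>A\<^esub> y)"
  by (rule sub.a_rcos_sum)

lemma cls_mult:
  assumes "x \<in> carrier A" "y \<in> carrier A"
  shows "rcoset_mult A I (cls x) (cls y) = cls (x \<otimes>\<^bsub>A\<^esub> y)"
proof -
  have "cls (a \<otimes>\<^bsub>A\<^esub> b) = cls (x \<otimes>\<^bsub>A\<^esub> y)" if "a \<in> cls x" "b \<in> cls y" for a b
  proof -
    obtain h where h: "h \<in> I" "a = h \<oplus>\<^bsub>A\<^esub> x" using \<open>a \<in> cls x\<close> by (rule cls_memE)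
    obtain g where g: "g \<in> I" "b = g \<oplus>\<^bsub>A\<^esub> y" using \<open>b \<in> cls y\<close> by (rule cls_memE)
    have c: "h \<in> carrier A" "g \<in> carrier A" using h g I_carrier by auto
    have "a \<otimes>\<^bsub>A\<^esub> b = (h \<otimes>\<^bsub>A\<^esub> b \<oplus>\<^bsub>A\<^esub> x \<otimes>\<^bsub>A\<^esub> g) \<oplus>\<^bsub>A\<^esub> x \<otimes>\<^bsub>A\<^esub> y"
      using h g c assms by (simp add: prod_add_left prod_add_right M.a_assoc M.a_lcomm)
    moreover have "h \<otimes>\<^bsub>A\<^esub> b \<oplus>\<^bsub>A\<^esub> x \<otimes>\<^bsub>A\<^esub> g \<in> I"
      using I_closed(3) I_closed(7)[of b h] I_closed(6)[of x g] h g c assms by auto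
    ultimately show ?thesis
      using cls_eqI[of "a \<otimes>\<^bsub>A\<^esub> b" "x \<otimes>\<^bsub>A\<^esub> y"] h g c assms by auto
  qed
  moreover have "x \<in> cls x" "y \<in> cls y" using assms sub.a_rcos_self by auto
  ultimately show ?thesis unfolding rcoset_mult_def by blast
qed

lemma cls_smult:
  assumes "x \<in> carrier A" "a \<in> carrier K"
  shows "(\<Union>z\<in>cls x. cls (a \<odot>\<^bsub>A\<^esub> z)) = cls (a \<odot>\<^bsub>A\<^esub> x)"
proof -
  have "cls (a \<odot>\<^bsub>A\<^esub> z) = cls (a \<odot>\<^bsub>A\<^esub> x)" if "z \<in> cls x" for z
  proof -
    obtain h where h: "h \<in> I" "z = h \<oplus>\<^bsub>A\<^esub> x" using \<open>z \<in> cls x\<close> by (rule cls_memE)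
    have c: "h \<in> carrier A" using h I_carrier by auto
    show ?thesis
    proof (rule cls_eqI)
      show "a \<odot>\<^bsub>A\<^esub> h \<in> I" using h assms I_closed(5) by blast
    qed (use h c assms in \<open>simp_all add: smult_r_distr\<close>)
  qed
  moreover have "x \<in> cls x" using assms sub.a_rcos_self by auto
  ultimately show ?thesis by blast
qed

abbreviation Q where "Q \<equiv> quot_algebra A I"

lemma Q_simps:
  "carrier Q = cls ` carrier A" "\<zero>\<^bsub>Q\<^esub> = I" "gr Q d = cls ` gr A d"
  "\<And>x y. \<lbrakk>x \<in> carrier A; y \<in> carrier A\<rbrakk> \<Longrightarrow> cls x \<oplus>\<^bsub>Q\<^esub> cls y = cls (x \<oplus>\<^bsub>A\<^esub> y)"
  "\<And>x y. \<lbrakk>x \<in> carrier A; y \<in> carrier A\<rbrakk> \<Longrightarrow> cls x \<otimes>\<^bsub>Q\<^esub> cls y = cls (x \<otimes>\<^bsub>A\<^esub> y)"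
  "\<And>a x. \<lbrakk>a \<in> carrier K; x \<in> carrier A\<rbrakk> \<Longrightarrow> a \<odot>\<^bsub>Q\<^esub> cls x = cls (a \<odot>\<^bsub>A\<^esub> x)"
  by (auto simp: quot_algebra_def A_RCOSETS_def' cls_add cls_mult cls_smult)

lemma cls_zero [simp]: "cls \<zero>\<^bsub>A\<^esub> = I"
  using a_coset_add_zero I_closed(1) by simp

lemma cls_zero_iff: "x \<in> carrier A \<Longrightarrow> cls x = I \<longleftrightarrow> x \<in> I"
  using a_coset_join1[OF _ _ sub.a_subgroup] a_coset_join2[OF _ sub.a_subgroup] by blast

lemma Q_carrierE:
  assumes "u \<in> carrier Q"
  obtains x where "x \<in> carrier A" "u = cls x"
  using assms by (auto simp: Q_simps)

lemma cls_Q [simp]: "x \<in> carrier A \<Longrightarrow> cls x \<in> carrier Q"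
  by (auto simp: Q_simps)

lemma Q_abelian: "abelian_group Q"
proof (rule abelian_groupI)
  fix u assume "u \<in> carrier Q"
  then obtain x where x: "x \<in> carrier A" "u = cls x" by (rule Q_carrierE)
  have "cls (\<ominus>\<^bsub>A\<^esub> x) \<oplus>\<^bsub>Q\<^esub> u = \<zero>\<^bsub>Q\<^esub>"
    using x by (simp add: Q_simps(2,4) M.l_neg)
  thus "\<exists>v\<in>carrier Q. v \<oplus>\<^bsub>Q\<^esub> u = \<zero>\<^bsub>Q\<^esub>" using x cls_Q by (meson M.a_inv_closed)
  show "\<zero>\<^bsub>Q\<^esub> \<oplus>\<^bsub>Q\<^esub> u = u"
    using x Q_simps(4)[of "\<zero>\<^bsub>A\<^esub>" x] by (simp add: Q_simps(2))
  fix v assume "v \<in> carrier Q"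
  then obtain y where y: "y \<in> carrier A" "v = cls y" by (rule Q_carrierE)
  show "u \<oplus>\<^bsub>Q\<^esub> v \<in> carrier Q" using x y by (simp add: Q_simps(4))
  show "u \<oplus>\<^bsub>Q\<^esub> v = v \<oplus>\<^bsub>Q\<^esub> u" using x y by (simp add: Q_simps(4) M.a_comm)
  fix w assume "w \<in> carrier Q"
  then obtain z where z: "z \<in> carrier A" "w = cls z" by (rule Q_carrierE)
  show "u \<oplus>\<^bsub>Q\<^esub> v \<oplus>\<^bsub>Q\<^esub> w = u \<oplus>\<^bsub>Q\<^esub> (v \<oplus>\<^bsub>Q\<^esub> w)"
    using x y z by (simp add: Q_simps(4) M.a_assoc)
next
  show "\<zero>\<^bsub>Q\<^esub> \<in> carrier Q" using cls_Q[of "\<zero>\<^bsub>A\<^esub>"] by (simp add: Q_simps(2))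
qed

lemma Q_nonassoc: "nonassoc_algebra K Q"
proof (rule nonassoc_algebra.intro)
  show "module K Q"
  proof (rule moduleI)
    show "cring K" by (rule R.is_cring)
  qed (auto simp: Q_abelian Q_simps(4,6) smult_l_distr smult_r_distr smult_assoc1 elim!: Q_carrierE)
  show "nonassoc_algebra_axioms K Q"
    by (rule nonassoc_algebra_axioms.intro)
       (auto simp: Q_simps(4,5,6) prod_add_left prod_add_right prod_smult_left prod_smult_right
         elim!: Q_carrierE)
qed

lemma cls_finsum:
  assumes "finite D" "\<And>d. d \<in> D \<Longrightarrow> f d \<in> carrier A"
  shows "cls (\<Oplus>\<^bsub>A\<^esub>d\<in>D. f d) = (\<Oplus>\<^bsub>Q\<^esub>d\<in>D. cls (f d))"
proof -
  interpret Q: nonassoc_algebra K Q by (rule Q_nonassoc)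
  show ?thesis using assms
  proof (induction D rule: finite_induct)
    case empty thus ?case using Q_simps(2) by simp
  next
    case (insert d D)
    have *: "f \<in> D \<rightarrow> carrier A" "f d \<in> carrier A" using insert by auto
    have **: "(\<lambda>d. cls (f d)) \<in> D \<rightarrow> carrier Q" "cls (f d) \<in> carrier Q"
      using insert.prems by (auto intro!: Pi_I cls_Q simp del: cls_Q)
    have "cls (\<Oplus>\<^bsub>A\<^esub>i\<in>insert d D. f i) = cls (f d \<oplus>\<^bsub>A\<^esub> (\<Oplus>\<^bsub>A\<^esub>i\<in>D. f i))"
      using M.finsum_insert[OF insert(1,2) *] by simp
    also have "\<dots> = cls (f d) \<oplus>\<^bsub>Q\<^esub> cls (\<Oplus>\<^bsub>A\<^esub>i\<in>D. f i)"
      by (rule Q_simps(4)[symmetric]) (use * in auto)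
    also have "\<dots> = (\<Oplus>\<^bsub>Q\<^esub>i\<in>insert d D. cls (f i))"
      using Q.M.finsum_insert[OF insert(1,2) **] insert by simp
    finally show ?case .
  qed
qed

end


subsection \<open>Gradings\<close>

context graded_nonassoc_algebra
begin

definition piece :: "'a \<Rightarrow> nat \<Rightarrow> 'a" where
  "piece x = (THE c. (\<forall>d. c d \<in> gr A d) \<and> finite {d. c d \<noteq> \<zero>\<^bsub>A\<^esub>}
     \<and> x = (\<Oplus>\<^bsub>A\<^esub>d\<in>{d. c d \<noteq> \<zero>\<^bsub>A\<^esub>}. c d))"

lemma gr_carrier: "x \<in> gr A d \<Longrightarrow> x \<in> carrier A"
  using submoduleE(1)[OF gr_submodule] by blast

lemma gr_zero: "\<zero>\<^bsub>A\<^esub> \<in> gr A d"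
  using subgroup.one_closed[OF submodule.axioms(1)[OF gr_submodule]] by simp

lemma gr_add: "\<lbrakk>x \<in> gr A d; y \<in> gr A d\<rbrakk> \<Longrightarrow> x \<oplus>\<^bsub>A\<^esub> y \<in> gr A d"
  by (rule submoduleE(5)[OF gr_submodule])

lemma gr_smult: "\<lbrakk>a \<in> carrier K; x \<in> gr A d\<rbrakk> \<Longrightarrow> a \<odot>\<^bsub>A\<^esub> x \<in> gr A d"
  by (rule submoduleE(4)[OF gr_submodule])

lemma finsum_supp:
  assumes "finite D" "{d. c d \<noteq> \<zero>\<^bsub>A\<^esub>} \<subseteq> D" "\<And>d. c d \<in> carrier A"
  shows "(\<Oplus>\<^bsub>A\<^esub>d\<in>D. c d) = (\<Oplus>\<^bsub>A\<^esub>d\<in>{d. c d \<noteq> \<zero>\<^bsub>A\<^esub>}. c d)"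
  by (rule add.finprod_mono_neutral_cong_left[symmetric]) (use assms in auto)

lemma
  assumes "x \<in> carrier A"
  shows piece_gr: "piece x d \<in> gr A d"
    and piece_finite: "finite {d. piece x d \<noteq> \<zero>\<^bsub>A\<^esub>}"
    and piece_sum: "x = (\<Oplus>\<^bsub>A\<^esub>d\<in>{d. piece x d \<noteq> \<zero>\<^bsub>A\<^esub>}. piece x d)"
  using theI'[OF gr_decomp[OF assms]] unfolding piece_def by auto

lemma piece_carrier: "x \<in> carrier A \<Longrightarrow> piece x d \<in> carrier A"
  using piece_gr gr_carrier by blast

lemma piece_sum':
  assumes "x \<in> carrier A" "finite D" "{d. piece x d \<noteq> \<zero>\<^bsub>A\<^esub>} \<subseteq> D"
  shows "(\<Oplus>\<^bsub>A\<^esub>d\<in>D. piece x d) = x"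
  using finsum_supp[OF assms(2,3) piece_carrier[OF assms(1)]] piece_sum[OF assms(1)] by (rule trans[OF _ sym])

lemma piece_sum_eq: "x \<in> carrier A \<Longrightarrow> (\<Oplus>\<^bsub>A\<^esub>d\<in>{d. piece x d \<noteq> \<zero>\<^bsub>A\<^esub>}. piece x d) = x"
  using piece_sum by (rule sym)

lemma pieceI:
  assumes "\<And>d. c d \<in> gr A d" "finite D" "{d. c d \<noteq> \<zero>\<^bsub>A\<^esub>} \<subseteq> D" "x = (\<Oplus>\<^bsub>A\<^esub>d\<in>D. c d)"
  shows "piece x = c"
proof -
  have c: "\<And>d. c d \<in> carrier A" using assms(1) gr_carrier by blast
  hence x: "x \<in> carrier A" using assms by auto
  have "finite {d. c d \<noteq> \<zero>\<^bsub>A\<^esub>}" using assms finite_subset by auto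
  moreover have "x = (\<Oplus>\<^bsub>A\<^esub>d\<in>{d. c d \<noteq> \<zero>\<^bsub>A\<^esub>}. c d)"
    using finsum_supp[OF assms(2,3) c] assms(4) by simp
  ultimately show ?thesis unfolding piece_def
    using the1_equality[OF gr_decomp[OF x], of c] assms(1) by auto
qed

lemma piece_add:
  assumes "x \<in> carrier A" "y \<in> carrier A"
  shows "piece (x \<oplus>\<^bsub>A\<^esub> y) = (\<lambda>d. piece x d \<oplus>\<^bsub>A\<^esub> piece y d)"
proof (rule pieceI[where D = "{d. piece x d \<noteq> \<zero>\<^bsub>A\<^esub>} \<union> {d. piece y d \<noteq> \<zero>\<^bsub>A\<^esub>}"])
  let ?D = "{d. piece x d \<noteq> \<zero>\<^bsub>A\<^esub>} \<union> {d. piece y d \<noteq> \<zero>\<^bsub>A\<^esub>}"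
  have "(\<Oplus>\<^bsub>A\<^esub>d\<in>?D. piece x d \<oplus>\<^bsub>A\<^esub> piece y d) = (\<Oplus>\<^bsub>A\<^esub>d\<in>?D. piece x d) \<oplus>\<^bsub>A\<^esub> (\<Oplus>\<^bsub>A\<^esub>d\<in>?D. piece y d)"
    by (rule finsum_addf) (use assms piece_carrier in auto)
  thus "x \<oplus>\<^bsub>A\<^esub> y = (\<Oplus>\<^bsub>A\<^esub>d\<in>?D. piece x d \<oplus>\<^bsub>A\<^esub> piece y d)"
    using piece_sum'[of x ?D] piece_sum'[of y ?D] assms piece_finite by auto
qed (use assms piece_gr piece_finite gr_add in auto)

lemma piece_smult:
  assumes "x \<in> carrier A" "a \<in> carrier K"
  shows "piece (a \<odot>\<^bsub>A\<^esub> x) = (\<lambda>d. a \<odot>\<^bsub>A\<^esub> piece x d)"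
proof (rule pieceI[where D = "{d. piece x d \<noteq> \<zero>\<^bsub>A\<^esub>}"])
  show "a \<odot>\<^bsub>A\<^esub> x = (\<Oplus>\<^bsub>A\<^esub>d\<in>{d. piece x d \<noteq> \<zero>\<^bsub>A\<^esub>}. a \<odot>\<^bsub>A\<^esub> piece x d)"
    using finsum_smult_ldistr[OF piece_finite[OF assms(1)] assms(2), of "piece x"]
      piece_carrier[OF assms(1)] piece_sum_eq[OF assms(1)] by (simp add: Pi_iff)
qed (use assms piece_gr piece_finite gr_smult in auto)

lemma piece_homog:
  assumes "x \<in> gr A e"
  shows "piece x = (\<lambda>d. if d = e then x else \<zero>\<^bsub>A\<^esub>)"
proof (rule pieceI[where D = "{e}"])
  show "x = (\<Oplus>\<^bsub>A\<^esub>d\<in>{e}. if d = e then x else \<zero>\<^bsub>A\<^esub>)" using assms gr_carrier by simp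
qed (use assms gr_zero in auto)

lemma piece_uminus:
  assumes "x \<in> carrier A"
  shows "piece (\<ominus>\<^bsub>A\<^esub> x) = (\<lambda>d. \<ominus>\<^bsub>A\<^esub> piece x d)"
proof -
  have "\<ominus>\<^bsub>A\<^esub> y = (\<ominus>\<^bsub>K\<^esub> \<one>\<^bsub>K\<^esub>) \<odot>\<^bsub>A\<^esub> y" if "y \<in> carrier A" for y
    using that by (simp add: smult_l_minus)
  thus ?thesis using piece_smult[OF assms, of "\<ominus>\<^bsub>K\<^esub> \<one>\<^bsub>K\<^esub>"] piece_carrier[OF assms] assms by simp
qed

lemma gr_finsum:
  assumes "finite D" "\<And>i. i \<in> D \<Longrightarrow> f i \<in> gr A d"
  shows "(\<Oplus>\<^bsub>A\<^esub>i\<in>D. f i) \<in> gr A d"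
  using assms
proof (induction D rule: finite_induct)
  case empty show ?case using gr_zero by simp
next
  case (insert i D)
  have "f \<in> D \<rightarrow> carrier A" "f i \<in> carrier A" using insert.prems gr_carrier by blast+
  thus ?case using M.finsum_insert[OF insert(1,2)] insert gr_add by simp
qed

definition homogeneous :: "'a set \<Rightarrow> bool" where
  "homogeneous I \<longleftrightarrow> (\<forall>x\<in>I. \<forall>d. piece x d \<in> I)"

lemma induct_homog [consumes 1, case_names add homog]:
  assumes "x \<in> carrier A"
    and add: "\<And>x y. \<lbrakk>x \<in> carrier A; y \<in> carrier A; P x; P y\<rbrakk> \<Longrightarrow> P (x \<oplus>\<^bsub>A\<^esub> y)"
    and homog: "\<And>x d. x \<in> gr A d \<Longrightarrow> P x"
  shows "P x"
proof -
  have "P (\<Oplus>\<^bsub>A\<^esub>d\<in>D. piece x d)" if "finite D" for D using that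
  proof (induction D rule: finite_induct)
    case empty show ?case using homog[OF gr_zero] by simp
  next
    case (insert d D)
    moreover have "P (piece x d \<oplus>\<^bsub>A\<^esub> (\<Oplus>\<^bsub>A\<^esub>i\<in>D. piece x i))"
      using piece_carrier[OF assms(1)] homog[OF piece_gr[OF assms(1)]] insert.IH by (intro add) auto
    ultimately show ?case using piece_carrier[OF assms(1)] by (simp add: Pi_iff)
  qed
  from this[OF piece_finite[OF assms(1)]] show ?thesis unfolding piece_sum_eq[OF assms(1)] .
qed

text \<open>The largest homogeneous ideal in a given ideal.\<close>

lemma ideal_homog_part:
  assumes I: "algebra_ideal K A I"
  shows "algebra_ideal K A {x \<in> I. \<forall>d. piece x d \<in> I}" (is "algebra_ideal K A ?J")
proof -
  note D = algebra_idealD[OF I]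
  have Ic: "x \<in> carrier A" if "x \<in> I" for x using D(1) that by auto
  have homogI: "x \<in> ?J" if "x \<in> I" "x \<in> gr A e" for x e
    using that piece_homog D(2) by auto
  have zero: "\<zero>\<^bsub>A\<^esub> \<in> ?J" by (rule homogI[OF D(2) gr_zero])
  have J_add: "x \<oplus>\<^bsub>A\<^esub> y \<in> ?J" if "x \<in> ?J" "y \<in> ?J" for x y
    using that D(3) Ic by (auto simp: piece_add)
  have sum: "(\<Oplus>\<^bsub>A\<^esub>d\<in>D. f d) \<in> ?J" if "finite D" "\<And>d. d \<in> D \<Longrightarrow> f d \<in> ?J" for f :: "nat \<Rightarrow> 'a" and D
    using that
  proof (induction D rule: finite_induct)
    case empty show ?case using zero by simp
  next
    case (insert d D)
    have "f \<in> D \<rightarrow> carrier A" "f d \<in> carrier A" using insert.prems Ic by auto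
    moreover have "f d \<oplus>\<^bsub>A\<^esub> (\<Oplus>\<^bsub>A\<^esub>i\<in>D. f i) \<in> ?J"
      by (rule J_add) (use insert in blast)+
    ultimately show ?case using M.finsum_insert[OF insert(1,2)] by simp
  qed
  have prod: "u \<otimes>\<^bsub>A\<^esub> x \<in> ?J \<and> x \<otimes>\<^bsub>A\<^esub> u \<in> ?J" if x: "x \<in> ?J" and u: "u \<in> carrier A" for x u
    using u
  proof (induction rule: induct_homog)
    case (add u v)
    have xc: "x \<in> carrier A" using x Ic by auto
    have "u \<otimes>\<^bsub>A\<^esub> x \<oplus>\<^bsub>A\<^esub> v \<otimes>\<^bsub>A\<^esub> x \<in> ?J" "x \<otimes>\<^bsub>A\<^esub> u \<oplus>\<^bsub>A\<^esub> x \<otimes>\<^bsub>A\<^esub> v \<in> ?J"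
      using add.IH J_add by blast+
    thus ?case unfolding prod_add_left[OF add.hyps xc] prod_add_right[OF add.hyps xc] by blast
  next
    case (homog u e)
    have xc: "x \<in> carrier A" using x Ic by auto
    have uc: "u \<in> carrier A" using homog gr_carrier by auto
    let ?D = "{d. piece x d \<noteq> \<zero>\<^bsub>A\<^esub>}"
    have fin: "finite ?D" by (rule piece_finite[OF xc])
    have l: "u \<otimes>\<^bsub>A\<^esub> (\<Oplus>\<^bsub>A\<^esub>d\<in>D. piece x d) = (\<Oplus>\<^bsub>A\<^esub>d\<in>D. u \<otimes>\<^bsub>A\<^esub> piece x d)"
     and r: "(\<Oplus>\<^bsub>A\<^esub>d\<in>D. piece x d) \<otimes>\<^bsub>A\<^esub> u = (\<Oplus>\<^bsub>A\<^esub>d\<in>D. piece x d \<otimes>\<^bsub>A\<^esub> u)" if "finite D" for D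
      using that
    proof (induction D rule: finite_induct)
      case empty
      have z: "\<zero>\<^bsub>A\<^esub> = \<zero>\<^bsub>K\<^esub> \<odot>\<^bsub>A\<^esub> \<zero>\<^bsub>A\<^esub>" by simp
      have "u \<otimes>\<^bsub>A\<^esub> \<zero>\<^bsub>A\<^esub> = \<zero>\<^bsub>A\<^esub>"
        by (subst z, subst prod_smult_right) (use uc in simp_all)
      moreover have "\<zero>\<^bsub>A\<^esub> \<otimes>\<^bsub>A\<^esub> u = \<zero>\<^bsub>A\<^esub>"
        by (subst z, subst prod_smult_left) (use uc in simp_all)
      ultimately
      show "u \<otimes>\<^bsub>A\<^esub> (\<Oplus>\<^bsub>A\<^esub>d\<in>{}. piece x d) = (\<Oplus>\<^bsub>A\<^esub>d\<in>{}. u \<otimes>\<^bsub>A\<^esub> piece x d)"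
        "(\<Oplus>\<^bsub>A\<^esub>d\<in>{}. piece x d) \<otimes>\<^bsub>A\<^esub> u = (\<Oplus>\<^bsub>A\<^esub>d\<in>{}. piece x d \<otimes>\<^bsub>A\<^esub> u)" by auto
    next
      case (insert d D)
      thus "u \<otimes>\<^bsub>A\<^esub> (\<Oplus>\<^bsub>A\<^esub>d\<in>insert d D. piece x d) = (\<Oplus>\<^bsub>A\<^esub>d\<in>insert d D. u \<otimes>\<^bsub>A\<^esub> piece x d)"
        "(\<Oplus>\<^bsub>A\<^esub>d\<in>insert d D. piece x d) \<otimes>\<^bsub>A\<^esub> u = (\<Oplus>\<^bsub>A\<^esub>d\<in>insert d D. piece x d \<otimes>\<^bsub>A\<^esub> u)"
        using uc xc piece_carrier by (auto simp: Pi_iff prod_add_left prod_add_right)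
    qed
    have ud: "u \<otimes>\<^bsub>A\<^esub> piece x d \<in> ?J" "piece x d \<otimes>\<^bsub>A\<^esub> u \<in> ?J" for d
    proof -
      have "piece x d \<in> I" using x by auto
      thus "u \<otimes>\<^bsub>A\<^esub> piece x d \<in> ?J" "piece x d \<otimes>\<^bsub>A\<^esub> u \<in> ?J"
        using homogI[OF D(6)[OF uc] gr_prod[OF homog piece_gr[OF xc]]]
          homogI[OF D(7)[OF uc] gr_prod[OF piece_gr[OF xc] homog]] by simp_all
    qed
    have "(\<Oplus>\<^bsub>A\<^esub>d\<in>?D. u \<otimes>\<^bsub>A\<^esub> piece x d) \<in> ?J" "(\<Oplus>\<^bsub>A\<^esub>d\<in>?D. piece x d \<otimes>\<^bsub>A\<^esub> u) \<in> ?J"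
      by (rule sum[OF fin], rule ud)+
    hence "u \<otimes>\<^bsub>A\<^esub> (\<Oplus>\<^bsub>A\<^esub>d\<in>?D. piece x d) \<in> ?J \<and> (\<Oplus>\<^bsub>A\<^esub>d\<in>?D. piece x d) \<otimes>\<^bsub>A\<^esub> u \<in> ?J"
      unfolding l[OF fin] r[OF fin] by (rule conjI)
    thus ?case unfolding piece_sum_eq[OF xc] .
  qed
  show ?thesis
  proof (rule algebra_idealI)
    show "?J \<subseteq> carrier A" using Ic by auto
    show "a \<odot>\<^bsub>A\<^esub> x \<in> ?J" if "a \<in> carrier K" "x \<in> ?J" for a x
      using that D(5) Ic by (auto simp: piece_smult)
  qed (use zero J_add prod in blast)+
qed

lemma homogeneous_ideal_span:
  assumes S: "S \<subseteq> carrier A"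
    and "\<And>s d. s \<in> S \<Longrightarrow> piece s d \<in> ideal_span K A S"
  shows "homogeneous (ideal_span K A S)"
proof -
  have "ideal_span K A S \<subseteq> {x \<in> ideal_span K A S. \<forall>d. piece x d \<in> ideal_span K A S}"
    by (rule ideal_span_minimal[OF ideal_homog_part[OF ideal_span_ideal[OF S]]])
       (use assms ideal_span_superset in blast)
  thus ?thesis unfolding homogeneous_def by auto
qed

end

locale graded_quotient = graded_nonassoc_algebra K A + algebra_quotient K A I
  for K (structure) and A :: "('k, 'a, 'm) graded_algebra_scheme" (structure) and I +
  assumes I_homog: "homogeneous I"
begin

lemma Q_graded: "graded_nonassoc_algebra K Q"
proof -
  interpret Q: nonassoc_algebra K Q by (rule Q_nonassoc)
  have uni: "c = (\<lambda>d. cls (piece x d))"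
    if x: "x \<in> carrier A" and c: "\<forall>d. c d \<in> gr Q d" "finite {d. c d \<noteq> \<zero>\<^bsub>Q\<^esub>}"
      "cls x = (\<Oplus>\<^bsub>Q\<^esub>d\<in>{d. c d \<noteq> \<zero>\<^bsub>Q\<^esub>}. c d)" for c x
  proof -
    let ?D = "{d. c d \<noteq> \<zero>\<^bsub>Q\<^esub>}"
    have "\<forall>d. \<exists>e. e \<in> gr A d \<and> c d = cls e \<and> (c d = I \<longrightarrow> e = \<zero>\<^bsub>A\<^esub>)"
    proof
      fix d
      show "\<exists>e. e \<in> gr A d \<and> c d = cls e \<and> (c d = I \<longrightarrow> e = \<zero>\<^bsub>A\<^esub>)"
      proof (cases "c d = I")
        case True thus ?thesis using gr_zero by (intro exI[of _ "\<zero>\<^bsub>A\<^esub>"]) auto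
      next
        case False thus ?thesis using c(1) by (auto simp: Q_simps(3))
      qed
    qed
    then obtain e where e: "\<And>d. e d \<in> gr A d" "\<And>d. c d = cls (e d)"
        "\<And>d. c d = I \<Longrightarrow> e d = \<zero>\<^bsub>A\<^esub>" by metis
    have ec: "e d \<in> carrier A" for d using e(1) gr_carrier by blast
    define y where "y = (\<Oplus>\<^bsub>A\<^esub>d\<in>?D. e d)"
    have yc: "y \<in> carrier A" unfolding y_def using ec by auto
    have ye: "piece y = e"
      by (rule pieceI[OF e(1) c(2) _ y_def]) (use e(3) in \<open>auto simp: Q_simps(2)\<close>)
    have "cls x = (\<Oplus>\<^bsub>Q\<^esub>d\<in>?D. cls (e d))" using c(3) e(2) by presburger
    also have "\<dots> = cls y" using cls_finsum[OF c(2) ec] y_def by simp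
    finally have "x \<ominus>\<^bsub>A\<^esub> y \<in> I" using cls_eq_iff x yc by blast
    hence "piece (x \<ominus>\<^bsub>A\<^esub> y) d \<in> I" for d using I_homog unfolding homogeneous_def by blast
    hence "piece x d \<ominus>\<^bsub>A\<^esub> e d \<in> I" for d
      using x yc ye by (auto simp: a_minus_def piece_add piece_uminus)
    hence "cls (piece x d) = cls (e d)" for d using cls_eq_iff ec piece_carrier[OF x] by blast
    thus ?thesis using e(2) by auto
  qed
  have ex: "(\<forall>d. cls (piece x d) \<in> gr Q d) \<and> finite {d. cls (piece x d) \<noteq> \<zero>\<^bsub>Q\<^esub>} \<and>
      cls x = (\<Oplus>\<^bsub>Q\<^esub>d\<in>{d. cls (piece x d) \<noteq> \<zero>\<^bsub>Q\<^esub>}. cls (piece x d))" if x: "x \<in> carrier A" for x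
  proof (intro conjI allI)
    let ?D = "{d. piece x d \<noteq> \<zero>\<^bsub>A\<^esub>}"
    have sub: "{d. cls (piece x d) \<noteq> \<zero>\<^bsub>Q\<^esub>} \<subseteq> ?D" by (auto simp: Q_simps(2))
    show "cls (piece x d) \<in> gr Q d" for d using piece_gr[OF x] by (auto simp: Q_simps(3))
    show "finite {d. cls (piece x d) \<noteq> \<zero>\<^bsub>Q\<^esub>}" using sub piece_finite[OF x] finite_subset by blast
    have "cls x = (\<Oplus>\<^bsub>Q\<^esub>d\<in>?D. cls (piece x d))"
      using cls_finsum[of ?D "piece x"] piece_finite[OF x] piece_carrier[OF x]
      unfolding piece_sum_eq[OF x] by blast
    also have "\<dots> = (\<Oplus>\<^bsub>Q\<^esub>d\<in>{d. cls (piece x d) \<noteq> \<zero>\<^bsub>Q\<^esub>}. cls (piece x d))"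
      by (rule Q.add.finprod_mono_neutral_cong_left[symmetric])
         (use sub piece_finite[OF x] piece_carrier[OF x] cls_Q in auto)
    finally show "cls x = (\<Oplus>\<^bsub>Q\<^esub>d\<in>{d. cls (piece x d) \<noteq> \<zero>\<^bsub>Q\<^esub>}. cls (piece x d))" .
  qed
  show ?thesis
  proof (rule graded_nonassoc_algebra.intro[OF Q_nonassoc], rule graded_nonassoc_algebra_axioms.intro)
    fix d
    show "submodule (gr Q d) K Q"
    proof (rule Q.submoduleI)
      show "gr Q d \<subseteq> carrier Q" using gr_carrier cls_Q by (auto simp: Q_simps(3))
      show "\<zero>\<^bsub>Q\<^esub> \<in> gr Q d" using gr_zero cls_zero unfolding Q_simps(2,3) by (metis imageI)
      show add: "u \<oplus>\<^bsub>Q\<^esub> v \<in> gr Q d" if "u \<in> gr Q d" "v \<in> gr Q d" for u v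
        using that gr_carrier gr_add by (auto simp: Q_simps(3,4))
      show sm: "a \<odot>\<^bsub>Q\<^esub> u \<in> gr Q d" if "a \<in> carrier K" "u \<in> gr Q d" for a u
        using that gr_carrier gr_smult by (auto simp: Q_simps(3,6))
      show "\<ominus>\<^bsub>Q\<^esub> u \<in> gr Q d" if u: "u \<in> gr Q d" for u
      proof -
        have "u \<in> carrier Q" using u gr_carrier cls_Q by (auto simp: Q_simps(3))
        hence "\<ominus>\<^bsub>Q\<^esub> u = (\<ominus>\<^bsub>K\<^esub> \<one>\<^bsub>K\<^esub>) \<odot>\<^bsub>Q\<^esub> u" by (simp add: Q.smult_l_minus)
        thus ?thesis using sm u by simp
      qed
    qed
  next
    fix u assume "u \<in> carrier Q"
    then obtain x where x: "x \<in> carrier A" "u = cls x" by (rule Q_carrierE)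
    show "\<exists>!c. (\<forall>d. c d \<in> gr Q d) \<and> finite {d. c d \<noteq> \<zero>\<^bsub>Q\<^esub>} \<and>
             u = (\<Oplus>\<^bsub>Q\<^esub>d\<in>{d. c d \<noteq> \<zero>\<^bsub>Q\<^esub>}. c d)"
      by (rule ex1I[of _ "\<lambda>d. cls (piece x d)"]) (use ex[OF x(1)] uni[OF x(1)] x(2) in blast)+
  next
    fix u v d e assume "u \<in> gr Q d" "v \<in> gr Q e"
    thus "u \<otimes>\<^bsub>Q\<^esub> v \<in> gr Q (d + e)"
      using gr_prod gr_carrier by (auto simp: Q_simps(3,5))
  qed
qed

end


subsection \<open>The free nonassociative algebra\<close>

lemma free_nonassoc_module:
  assumes "cring K"
  shows "module K (free_nonassoc K S)"
proof -
  interpret R: cring K by fact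
  let ?A = "free_nonassoc K S"
  have car: "f \<in> carrier ?A \<longleftrightarrow> f \<in> free_nonassoc_carrier K S" for f by (simp add: free_nonassoc_def)
  have D: "f t \<in> carrier K" if "f \<in> free_nonassoc_carrier K S" for f t
    using that by (simp add: free_nonassoc_carrier_def)
  have add: "(\<lambda>t. f t \<oplus>\<^bsub>K\<^esub> g t) \<in> free_nonassoc_carrier K S"
    if f: "f \<in> free_nonassoc_carrier K S" and g: "g \<in> free_nonassoc_carrier K S" for f g
  proof -
    have "{t. f t \<oplus>\<^bsub>K\<^esub> g t \<noteq> \<zero>\<^bsub>K\<^esub>} \<subseteq> {t. f t \<noteq> \<zero>\<^bsub>K\<^esub>} \<union> {t. g t \<noteq> \<zero>\<^bsub>K\<^esub>}" by auto
    moreover have "finite ({t. f t \<noteq> \<zero>\<^bsub>K\<^esub>} \<union> {t. g t \<noteq> \<zero>\<^bsub>K\<^esub>})"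
      using f g by (simp add: free_nonassoc_carrier_def)
    ultimately have "finite {t. f t \<oplus>\<^bsub>K\<^esub> g t \<noteq> \<zero>\<^bsub>K\<^esub>}" by (rule finite_subset)
    moreover have "set_free_magma t \<subseteq> S" if "f t \<oplus>\<^bsub>K\<^esub> g t \<noteq> \<zero>\<^bsub>K\<^esub>" for t
    proof -
      have "f t \<noteq> \<zero>\<^bsub>K\<^esub> \<or> g t \<noteq> \<zero>\<^bsub>K\<^esub>" using that by auto
      thus ?thesis using f g unfolding free_nonassoc_carrier_def by blast
    qed
    ultimately show ?thesis using D[OF f] D[OF g] by (simp add: free_nonassoc_carrier_def)
  qed
  have smult: "(\<lambda>t. a \<otimes>\<^bsub>K\<^esub> f t) \<in> free_nonassoc_carrier K S"
    if f: "f \<in> free_nonassoc_carrier K S" and a: "a \<in> carrier K" for f a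
  proof -
    have "{t. a \<otimes>\<^bsub>K\<^esub> f t \<noteq> \<zero>\<^bsub>K\<^esub>} \<subseteq> {t. f t \<noteq> \<zero>\<^bsub>K\<^esub>}" using a by auto
    moreover have "finite {t. f t \<noteq> \<zero>\<^bsub>K\<^esub>}"
      using f by (simp add: free_nonassoc_carrier_def)
    ultimately have "finite {t. a \<otimes>\<^bsub>K\<^esub> f t \<noteq> \<zero>\<^bsub>K\<^esub>}" by (rule finite_subset)
    moreover have "set_free_magma t \<subseteq> S" if "a \<otimes>\<^bsub>K\<^esub> f t \<noteq> \<zero>\<^bsub>K\<^esub>" for t
    proof -
      have "f t \<noteq> \<zero>\<^bsub>K\<^esub>" using that a by auto
      thus ?thesis using f unfolding free_nonassoc_carrier_def by blast
    qed
    ultimately show ?thesis using D[OF f] a by (simp add: free_nonassoc_carrier_def)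
  qed
  have neg: "(\<lambda>t. \<ominus>\<^bsub>K\<^esub> f t) \<in> free_nonassoc_carrier K S" if f: "f \<in> free_nonassoc_carrier K S" for f
  proof -
    have "(\<lambda>t. \<ominus>\<^bsub>K\<^esub> f t) = (\<lambda>t. (\<ominus>\<^bsub>K\<^esub> \<one>\<^bsub>K\<^esub>) \<otimes>\<^bsub>K\<^esub> f t)" using D[OF f] by (simp add: R.l_minus)
    thus ?thesis using smult[OF f, of "\<ominus>\<^bsub>K\<^esub> \<one>\<^bsub>K\<^esub>"] by simp
  qed
  have ops: "\<zero>\<^bsub>?A\<^esub> = (\<lambda>t. \<zero>\<^bsub>K\<^esub>)" "f \<oplus>\<^bsub>?A\<^esub> g = (\<lambda>t. f t \<oplus>\<^bsub>K\<^esub> g t)"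
    "a \<odot>\<^bsub>?A\<^esub> f = (\<lambda>t. a \<otimes>\<^bsub>K\<^esub> f t)" for f g a
    by (simp_all add: free_nonassoc_def)
  have "abelian_group ?A"
  proof (rule abelian_groupI, unfold car ops)
    fix f assume f: "f \<in> free_nonassoc_carrier K S"
    show "\<exists>g\<in>carrier ?A. (\<lambda>t. g t \<oplus>\<^bsub>K\<^esub> f t) = (\<lambda>t. \<zero>\<^bsub>K\<^esub>)"
      by (rule bexI[of _ "\<lambda>t. \<ominus>\<^bsub>K\<^esub> f t"]) (simp_all add: car neg f D R.l_neg)
  next
    show "(\<lambda>t. \<zero>\<^bsub>K\<^esub>) \<in> free_nonassoc_carrier K S" by (simp add: free_nonassoc_carrier_def)
  qed (simp_all add: add D R.a_ac)
  thus ?thesis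
    by (intro moduleI assms; (unfold car ops)?)
       (simp_all add: smult D R.l_distr R.r_distr R.m_assoc)
qed

lemma free_nonassoc_nonassoc:
  assumes "cring K"
  shows "nonassoc_algebra K (free_nonassoc K S)"
proof (rule nonassoc_algebra.intro[OF free_nonassoc_module[OF assms]])
  interpret R: cring K by fact
  have D: "f t \<in> carrier K" if "f \<in> free_nonassoc_carrier K S" for f t
    using that by (simp add: free_nonassoc_carrier_def)
  have prod: "(\<lambda>t. case t of Gen x \<Rightarrow> \<zero>\<^bsub>K\<^esub> | Br s u \<Rightarrow> f s \<otimes>\<^bsub>K\<^esub> g u) \<in> free_nonassoc_carrier K S"
    if f: "f \<in> free_nonassoc_carrier K S" and g: "g \<in> free_nonassoc_carrier K S" for f g
  proof -
    let ?h = "\<lambda>t. case t of Gen x \<Rightarrow> \<zero>\<^bsub>K\<^esub> | Br s u \<Rightarrow> f s \<otimes>\<^bsub>K\<^esub> g u"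
    have nz: "\<exists>s u. t = Br s u \<and> f s \<noteq> \<zero>\<^bsub>K\<^esub> \<and> g u \<noteq> \<zero>\<^bsub>K\<^esub>" if "?h t \<noteq> \<zero>\<^bsub>K\<^esub>" for t
      using that D[OF f] D[OF g] by (cases t) auto
    hence "{t. ?h t \<noteq> \<zero>\<^bsub>K\<^esub>} \<subseteq> (\<lambda>(s, u). Br s u) ` ({t. f t \<noteq> \<zero>\<^bsub>K\<^esub>} \<times> {t. g t \<noteq> \<zero>\<^bsub>K\<^esub>})" by fast
    hence "finite {t. ?h t \<noteq> \<zero>\<^bsub>K\<^esub>}"
      by (rule finite_subset) (use f g in \<open>auto simp: free_nonassoc_carrier_def\<close>)
    moreover have "set_free_magma t \<subseteq> S" if ht: "?h t \<noteq> \<zero>\<^bsub>K\<^esub>" for t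
    proof -
      obtain s u where "t = Br s u" "f s \<noteq> \<zero>\<^bsub>K\<^esub>" "g u \<noteq> \<zero>\<^bsub>K\<^esub>" using nz[OF ht] by blast
      moreover have "set_free_magma s \<subseteq> S" "set_free_magma u \<subseteq> S"
        using f g calculation by (simp_all add: free_nonassoc_carrier_def)
      ultimately show ?thesis by simp
    qed
    moreover have "?h t \<in> carrier K" for t using D[OF f] D[OF g] by (cases t) auto
    ultimately show ?thesis by (simp add: free_nonassoc_carrier_def)
  qed
  show "nonassoc_algebra_axioms K (free_nonassoc K S)"
    by (rule nonassoc_algebra_axioms.intro)
       (use prod D in \<open>auto simp: free_nonassoc_def fun_eq_iff R.l_distr R.r_distr R.m_assoc R.m_lcomm
          split: free_magma.splits\<close>)
qed

lemma free_nonassoc_finsum: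
  assumes "cring K" "finite D" "\<And>d. d \<in> D \<Longrightarrow> c d \<in> carrier (free_nonassoc K S)"
  shows "(\<Oplus>\<^bsub>free_nonassoc K S\<^esub>d\<in>D. c d) t = (\<Oplus>\<^bsub>K\<^esub>d\<in>D. c d t)"
proof -
  interpret A: module K "free_nonassoc K S" by (rule free_nonassoc_module[OF assms(1)])
  show ?thesis using assms(2,3)
  proof (induction D rule: finite_induct)
    case empty show ?case
      unfolding A.M.finsum_empty A.R.finsum_empty by (simp add: free_nonassoc_def)
  next
    case (insert d D)
    have c: "c \<in> D \<rightarrow> carrier (free_nonassoc K S)" "c d \<in> carrier (free_nonassoc K S)"
      using insert.prems by auto
    have ct: "(\<lambda>d. c d t) \<in> D \<rightarrow> carrier K" "c d t \<in> carrier K"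
      using insert.prems by (auto simp: free_nonassoc_def free_nonassoc_carrier_def)
    have "(\<Oplus>\<^bsub>free_nonassoc K S\<^esub>d\<in>insert d D. c d) t
        = c d t \<oplus>\<^bsub>K\<^esub> (\<Oplus>\<^bsub>free_nonassoc K S\<^esub>d\<in>D. c d) t"
      unfolding A.M.finsum_insert[OF insert(1,2) c] by (simp add: free_nonassoc_def)
    also have "\<dots> = (\<Oplus>\<^bsub>K\<^esub>d\<in>insert d D. c d t)"
      using A.R.finsum_insert[OF insert(1,2) ct] insert by simp
    finally show ?case .
  qed
qed

lemma free_nonassoc_graded:
  assumes "cring K"
  shows "graded_nonassoc_algebra K (free_nonassoc K S)"
proof (rule graded_nonassoc_algebra.intro[OF free_nonassoc_nonassoc[OF assms]],
       rule graded_nonassoc_algebra_axioms.intro)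
  let ?A = "free_nonassoc K S"
  interpret A: nonassoc_algebra K ?A by (rule free_nonassoc_nonassoc[OF assms])
  have grI: "f \<in> gr ?A d \<longleftrightarrow> f \<in> carrier ?A \<and> (\<forall>t. f t \<noteq> \<zero>\<^bsub>K\<^esub> \<longrightarrow> leaves t = d)" for f d
    by (simp add: free_nonassoc_def)
  have D: "f t \<in> carrier K" if "f \<in> carrier ?A" for f t
    using that by (simp add: free_nonassoc_def free_nonassoc_carrier_def)
  have ops: "(f \<oplus>\<^bsub>?A\<^esub> g) t = f t \<oplus>\<^bsub>K\<^esub> g t" "\<zero>\<^bsub>?A\<^esub> t = \<zero>\<^bsub>K\<^esub>" "(a \<odot>\<^bsub>?A\<^esub> f) t = a \<otimes>\<^bsub>K\<^esub> f t" for f g t a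
    by (simp_all add: free_nonassoc_def)
  fix d
  have sm: "a \<odot>\<^bsub>?A\<^esub> f \<in> gr ?A d" if "a \<in> carrier K" "f \<in> gr ?A d" for a f
  proof -
    have "leaves t = d" if "a \<otimes>\<^bsub>K\<^esub> f t \<noteq> \<zero>\<^bsub>K\<^esub>" for t
    proof (rule ccontr)
      assume "leaves t \<noteq> d"
      hence "f t = \<zero>\<^bsub>K\<^esub>" using \<open>f \<in> gr ?A d\<close> unfolding grI by blast
      thus False using that \<open>a \<in> carrier K\<close> by simp
    qed
    thus ?thesis using that by (simp add: grI ops)
  qed
  show "submodule (gr ?A d) K ?A"
  proof (rule A.submoduleI)
    show "\<ominus>\<^bsub>?A\<^esub> f \<in> gr ?A d" if f: "f \<in> gr ?A d" for f
    proof -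
      have "f \<in> carrier ?A" using f by (simp add: grI)
      hence "\<ominus>\<^bsub>?A\<^esub> f = (\<ominus>\<^bsub>K\<^esub> \<one>\<^bsub>K\<^esub>) \<odot>\<^bsub>?A\<^esub> f" by (simp add: A.smult_l_minus)
      thus ?thesis using sm f by simp
    qed
    show "f \<oplus>\<^bsub>?A\<^esub> g \<in> gr ?A d" if "f \<in> gr ?A d" "g \<in> gr ?A d" for f g
    proof -
      have "leaves t = d" if nz: "f t \<oplus>\<^bsub>K\<^esub> g t \<noteq> \<zero>\<^bsub>K\<^esub>" for t
      proof (rule ccontr)
        assume "leaves t \<noteq> d"
        hence "f t = \<zero>\<^bsub>K\<^esub>" "g t = \<zero>\<^bsub>K\<^esub>" using \<open>f \<in> gr ?A d\<close> \<open>g \<in> gr ?A d\<close> unfolding grI by blast+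
        thus False using nz by simp
      qed
      thus ?thesis using \<open>f \<in> gr ?A d\<close> \<open>g \<in> gr ?A d\<close> by (simp add: grI ops)
    qed
  qed (use sm in \<open>auto simp: grI ops\<close>)
next
  let ?A = "free_nonassoc K S"
  interpret A: nonassoc_algebra K ?A by (rule free_nonassoc_nonassoc[OF assms])
  have grI: "f \<in> gr ?A d \<longleftrightarrow> f \<in> carrier ?A \<and> (\<forall>t. f t \<noteq> \<zero>\<^bsub>K\<^esub> \<longrightarrow> leaves t = d)" for f d
    by (simp add: free_nonassoc_def)
  have D: "f t \<in> carrier K" if "f \<in> carrier ?A" for f t
    using that by (simp add: free_nonassoc_def free_nonassoc_carrier_def)
  have zero: "\<zero>\<^bsub>?A\<^esub> = (\<lambda>t. \<zero>\<^bsub>K\<^esub>)" by (simp add: free_nonassoc_def)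
  fix f assume f: "f \<in> carrier ?A"
  define p where "p = (\<lambda>d t. if leaves t = d then f t else \<zero>\<^bsub>K\<^esub>)"
  have ev: "(\<Oplus>\<^bsub>?A\<^esub>d\<in>{d. c d \<noteq> \<zero>\<^bsub>?A\<^esub>}. c d) t = c (leaves t) t"
    if c: "\<And>d. c d \<in> gr ?A d" "finite {d. c d \<noteq> \<zero>\<^bsub>?A\<^esub>}" for c t
  proof -
    have cc: "c d \<in> carrier ?A" for d using c(1) unfolding grI by blast
    have nz: "c d t = \<zero>\<^bsub>K\<^esub>" if "d \<noteq> leaves t" for d
      using c(1)[of d] that unfolding grI by auto
    have "(\<Oplus>\<^bsub>?A\<^esub>d\<in>{d. c d \<noteq> \<zero>\<^bsub>?A\<^esub>}. c d) t = (\<Oplus>\<^bsub>K\<^esub>d\<in>{d. c d \<noteq> \<zero>\<^bsub>?A\<^esub>}. c d t)"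
      using free_nonassoc_finsum[OF assms c(2) cc] .
    also have "\<dots> = (\<Oplus>\<^bsub>K\<^esub>d\<in>{d. c d \<noteq> \<zero>\<^bsub>?A\<^esub>} \<union> {leaves t}. c d t)"
      by (rule A.R.add.finprod_mono_neutral_cong_left) (use c(2) D[OF cc] zero in auto)
    also have "\<dots> = (\<Oplus>\<^bsub>K\<^esub>d\<in>{leaves t}. c d t)"
      by (rule A.R.add.finprod_mono_neutral_cong_left[symmetric]) (use c(2) D[OF cc] nz in auto)
    also have "\<dots> = c (leaves t) t" using D[OF cc] by simp
    finally show ?thesis .
  qed
  have pgr: "p d \<in> gr ?A d" for d
  proof -
    have "{t. p d t \<noteq> \<zero>\<^bsub>K\<^esub>} \<subseteq> {t. f t \<noteq> \<zero>\<^bsub>K\<^esub>}" by (auto simp: p_def)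
    hence "finite {t. p d t \<noteq> \<zero>\<^bsub>K\<^esub>}" using f finite_subset
      by (auto simp: free_nonassoc_def free_nonassoc_carrier_def)
    thus ?thesis using f unfolding grI
      by (auto simp: free_nonassoc_def free_nonassoc_carrier_def p_def split: if_splits)
  qed
  have pfin: "finite {d. p d \<noteq> \<zero>\<^bsub>?A\<^esub>}"
  proof (rule finite_subset)
    show "{d. p d \<noteq> \<zero>\<^bsub>?A\<^esub>} \<subseteq> leaves ` {t. f t \<noteq> \<zero>\<^bsub>K\<^esub>}" by (auto simp: p_def zero fun_eq_iff split: if_splits)
    show "finite (leaves ` {t. f t \<noteq> \<zero>\<^bsub>K\<^esub>})"
      using f by (auto simp: free_nonassoc_def free_nonassoc_carrier_def)
  qed
  show "\<exists>!c. (\<forall>d. c d \<in> gr ?A d) \<and> finite {d. c d \<noteq> \<zero>\<^bsub>?A\<^esub>}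
          \<and> f = (\<Oplus>\<^bsub>?A\<^esub>d\<in>{d. c d \<noteq> \<zero>\<^bsub>?A\<^esub>}. c d)"
  proof (rule ex1I[of _ p], intro conjI allI)
    show "f = (\<Oplus>\<^bsub>?A\<^esub>d\<in>{d. p d \<noteq> \<zero>\<^bsub>?A\<^esub>}. p d)"
      by (rule ext, subst ev[OF pgr pfin]) (simp add: p_def)
    fix c assume c: "(\<forall>d. c d \<in> gr ?A d) \<and> finite {d. c d \<noteq> \<zero>\<^bsub>?A\<^esub>}
          \<and> f = (\<Oplus>\<^bsub>?A\<^esub>d\<in>{d. c d \<noteq> \<zero>\<^bsub>?A\<^esub>}. c d)"
    have eq: "f t = c (leaves t) t" for t using ev[of c t] c by metis
    have "c d t = p d t" for d t
    proof (cases "leaves t = d")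
      case True thus ?thesis using eq[of t] by (simp add: p_def)
    next
      case False
      moreover have "c d t \<noteq> \<zero>\<^bsub>K\<^esub> \<longrightarrow> leaves t = d" using c unfolding grI by blast
      ultimately show ?thesis by (simp add: p_def)
    qed
    thus "c = p" by (intro ext)
  qed (use pgr pfin in auto)
next
  let ?A = "free_nonassoc K S"
  interpret A: nonassoc_algebra K ?A by (rule free_nonassoc_nonassoc[OF assms])
  fix f g d e assume f: "f \<in> gr ?A d" and g: "g \<in> gr ?A e"
  have grI: "f \<in> gr ?A d \<longleftrightarrow> f \<in> carrier ?A \<and> (\<forall>t. f t \<noteq> \<zero>\<^bsub>K\<^esub> \<longrightarrow> leaves t = d)" for f d
    by (simp add: free_nonassoc_def)
  have fc: "f t \<in> carrier K" "g t \<in> carrier K" for t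
    using f g by (simp_all add: free_nonassoc_def free_nonassoc_carrier_def)
  have "leaves t = d + e" if nz: "(f \<otimes>\<^bsub>?A\<^esub> g) t \<noteq> \<zero>\<^bsub>K\<^esub>" for t
  proof (cases t)
    case (Gen x) thus ?thesis using nz by (simp add: free_nonassoc_def)
  next
    case (Br s u)
    hence "f s \<otimes>\<^bsub>K\<^esub> g u \<noteq> \<zero>\<^bsub>K\<^esub>" using nz by (simp add: free_nonassoc_def)
    hence "f s \<noteq> \<zero>\<^bsub>K\<^esub>" "g u \<noteq> \<zero>\<^bsub>K\<^esub>" using fc by auto
    hence "leaves s = d" "leaves u = e" using f g unfolding grI by blast+
    thus ?thesis using Br by simp
  qed
  thus "f \<otimes>\<^bsub>?A\<^esub> g \<in> gr ?A (d + e)" using f g by (auto simp: grI)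
qed

subsection \<open>Free Lie algebras and Yang-Mills algebras are graded Lie algebras\<close>

context nonassoc_algebra
begin

lemma lie_relators_carrier: "lie_relators A \<subseteq> carrier A"
  unfolding lie_relators_def by auto

end

context algebra_quotient
begin

lemma Q_lie:
  assumes K: "field K" and rel: "lie_relators A \<subseteq> I"
  shows "lie_algebra K Q"
proof (rule lie_algebra.intro[OF Q_nonassoc K], rule lie_algebra_axioms.intro)
  fix u assume "u \<in> carrier Q"
  then obtain x where x: "x \<in> carrier A" "u = cls x" by (rule Q_carrierE)
  have "x \<otimes>\<^bsub>A\<^esub> x \<in> I" using rel x by (auto simp: lie_relators_def)
  thus "u \<otimes>\<^bsub>Q\<^esub> u = \<zero>\<^bsub>Q\<^esub>" using x by (simp add: Q_simps(2,5) cls_zero_iff)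
  fix v assume "v \<in> carrier Q"
  then obtain y where y: "y \<in> carrier A" "v = cls y" by (rule Q_carrierE)
  fix w assume "w \<in> carrier Q"
  then obtain z where z: "z \<in> carrier A" "w = cls z" by (rule Q_carrierE)
  have "x \<otimes>\<^bsub>A\<^esub> (y \<otimes>\<^bsub>A\<^esub> z) \<oplus>\<^bsub>A\<^esub> y \<otimes>\<^bsub>A\<^esub> (z \<otimes>\<^bsub>A\<^esub> x) \<oplus>\<^bsub>A\<^esub> z \<otimes>\<^bsub>A\<^esub> (x \<otimes>\<^bsub>A\<^esub> y) \<in> I"
    using rel x y z unfolding lie_relators_def by blast
  thus "u \<otimes>\<^bsub>Q\<^esub> (v \<otimes>\<^bsub>Q\<^esub> w) \<oplus>\<^bsub>Q\<^esub> v \<otimes>\<^bsub>Q\<^esub> (w \<otimes>\<^bsub>Q\<^esub> u) \<oplus>\<^bsub>Q\<^esub> w \<otimes>\<^bsub>Q\<^esub> (u \<otimes>\<^bsub>Q\<^esub> v) = \<zero>\<^bsub>Q\<^esub>"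
    using x y z by (simp add: Q_simps(2,4,5) cls_zero_iff)
qed

end

context graded_nonassoc_algebra
begin

lemma homogeneous_lie_relators: "homogeneous (ideal_span K A (lie_relators A))"
proof -
  let ?I = "ideal_span K A (lie_relators A)"
  let ?J = "{x \<in> ?I. \<forall>d. piece x d \<in> ?I}"
  have I: "algebra_ideal K A ?I" by (rule ideal_span_ideal[OF lie_relators_carrier])
  note D = algebra_idealD[OF I]
  note J_add = algebra_idealD(3)[OF ideal_homog_part[OF I]]
  have homogI: "x \<in> ?J" if "x \<in> ?I" "x \<in> gr A e" for x e
    using that piece_homog D(2) by auto
  have sq: "x \<otimes>\<^bsub>A\<^esub> x \<in> ?I" if "x \<in> carrier A" for x
    using that ideal_span_superset[of "lie_relators A"] by (auto simp: lie_relators_def)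
  have jac: "x \<otimes>\<^bsub>A\<^esub> (y \<otimes>\<^bsub>A\<^esub> z) \<oplus>\<^bsub>A\<^esub> y \<otimes>\<^bsub>A\<^esub> (z \<otimes>\<^bsub>A\<^esub> x) \<oplus>\<^bsub>A\<^esub> z \<otimes>\<^bsub>A\<^esub> (x \<otimes>\<^bsub>A\<^esub> y) \<in> ?I"
    if "x \<in> carrier A" "y \<in> carrier A" "z \<in> carrier A" for x y z
    using that ideal_span_superset[of "lie_relators A"] unfolding lie_relators_def by blast
  have anti: "x \<otimes>\<^bsub>A\<^esub> y \<oplus>\<^bsub>A\<^esub> y \<otimes>\<^bsub>A\<^esub> x \<in> ?I" if x: "x \<in> carrier A" and y: "y \<in> carrier A" for x y
  proof -
    have "(x \<oplus>\<^bsub>A\<^esub> y) \<otimes>\<^bsub>A\<^esub> (x \<oplus>\<^bsub>A\<^esub> y) \<oplus>\<^bsub>A\<^esub> (\<ominus>\<^bsub>A\<^esub> (x \<otimes>\<^bsub>A\<^esub> x) \<oplus>\<^bsub>A\<^esub> \<ominus>\<^bsub>A\<^esub> (y \<otimes>\<^bsub>A\<^esub> y)) \<in> ?I"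
      by (intro D(3,4) sq x y M.a_closed)
    also have "(x \<oplus>\<^bsub>A\<^esub> y) \<otimes>\<^bsub>A\<^esub> (x \<oplus>\<^bsub>A\<^esub> y) \<oplus>\<^bsub>A\<^esub> (\<ominus>\<^bsub>A\<^esub> (x \<otimes>\<^bsub>A\<^esub> x) \<oplus>\<^bsub>A\<^esub> \<ominus>\<^bsub>A\<^esub> (y \<otimes>\<^bsub>A\<^esub> y))
        = (x \<otimes>\<^bsub>A\<^esub> y \<oplus>\<^bsub>A\<^esub> y \<otimes>\<^bsub>A\<^esub> x) \<oplus>\<^bsub>A\<^esub>
          ((x \<otimes>\<^bsub>A\<^esub> x \<oplus>\<^bsub>A\<^esub> \<ominus>\<^bsub>A\<^esub> (x \<otimes>\<^bsub>A\<^esub> x)) \<oplus>\<^bsub>A\<^esub> (y \<otimes>\<^bsub>A\<^esub> y \<oplus>\<^bsub>A\<^esub> \<ominus>\<^bsub>A\<^esub> (y \<otimes>\<^bsub>A\<^esub> y)))"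
      using x y by (simp only: prod_add_left prod_add_right M.a_ac M.a_closed prod_closed M.a_inv_closed)
    also have "\<dots> = x \<otimes>\<^bsub>A\<^esub> y \<oplus>\<^bsub>A\<^esub> y \<otimes>\<^bsub>A\<^esub> x" using x y by (simp add: M.r_neg)
    finally show ?thesis .
  qed
  have J_anti: "x \<otimes>\<^bsub>A\<^esub> y \<oplus>\<^bsub>A\<^esub> y \<otimes>\<^bsub>A\<^esub> x \<in> ?J" if "x \<in> carrier A" and y: "y \<in> carrier A" for x y
    using that(1)
  proof (induction x rule: induct_homog)
    case (add u v)
    have "(u \<otimes>\<^bsub>A\<^esub> y \<oplus>\<^bsub>A\<^esub> y \<otimes>\<^bsub>A\<^esub> u) \<oplus>\<^bsub>A\<^esub> (v \<otimes>\<^bsub>A\<^esub> y \<oplus>\<^bsub>A\<^esub> y \<otimes>\<^bsub>A\<^esub> v) \<in> ?J"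
      by (rule J_add[OF add.IH])
    also have "(u \<otimes>\<^bsub>A\<^esub> y \<oplus>\<^bsub>A\<^esub> y \<otimes>\<^bsub>A\<^esub> u) \<oplus>\<^bsub>A\<^esub> (v \<otimes>\<^bsub>A\<^esub> y \<oplus>\<^bsub>A\<^esub> y \<otimes>\<^bsub>A\<^esub> v)
        = (u \<oplus>\<^bsub>A\<^esub> v) \<otimes>\<^bsub>A\<^esub> y \<oplus>\<^bsub>A\<^esub> y \<otimes>\<^bsub>A\<^esub> (u \<oplus>\<^bsub>A\<^esub> v)"
      using add.hyps y by (simp only: prod_add_left prod_add_right M.a_ac M.a_closed prod_closed)
    finally show ?case .
  next
    case (homog u d)
    note u = homog gr_carrier[OF homog]
    show ?case using y
    proof (induction y rule: induct_homog)
      case (add v w)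
      have "(u \<otimes>\<^bsub>A\<^esub> v \<oplus>\<^bsub>A\<^esub> v \<otimes>\<^bsub>A\<^esub> u) \<oplus>\<^bsub>A\<^esub> (u \<otimes>\<^bsub>A\<^esub> w \<oplus>\<^bsub>A\<^esub> w \<otimes>\<^bsub>A\<^esub> u) \<in> ?J"
        by (rule J_add[OF add.IH])
      also have "(u \<otimes>\<^bsub>A\<^esub> v \<oplus>\<^bsub>A\<^esub> v \<otimes>\<^bsub>A\<^esub> u) \<oplus>\<^bsub>A\<^esub> (u \<otimes>\<^bsub>A\<^esub> w \<oplus>\<^bsub>A\<^esub> w \<otimes>\<^bsub>A\<^esub> u)
          = u \<otimes>\<^bsub>A\<^esub> (v \<oplus>\<^bsub>A\<^esub> w) \<oplus>\<^bsub>A\<^esub> (v \<oplus>\<^bsub>A\<^esub> w) \<otimes>\<^bsub>A\<^esub> u"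
        using add.hyps u(2) by (simp only: prod_add_left prod_add_right M.a_ac M.a_closed prod_closed)
      finally show ?case .
    next
      case (homog v e)
      show ?case
        using homogI[OF anti[OF u(2) gr_carrier[OF homog]], of "d + e"]
          gr_add[OF gr_prod[OF u(1) homog]] gr_prod[OF homog u(1)] by (simp add: add.commute)
    qed
  qed
  have J_sq: "x \<otimes>\<^bsub>A\<^esub> x \<in> ?J" if "x \<in> carrier A" for x using that
  proof (induction x rule: induct_homog)
    case (add u v)
    have "(u \<otimes>\<^bsub>A\<^esub> u \<oplus>\<^bsub>A\<^esub> v \<otimes>\<^bsub>A\<^esub> v) \<oplus>\<^bsub>A\<^esub> (u \<otimes>\<^bsub>A\<^esub> v \<oplus>\<^bsub>A\<^esub> v \<otimes>\<^bsub>A\<^esub> u) \<in> ?J"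
      by (rule J_add[OF J_add[OF add.IH] J_anti[OF add.hyps]])
    also have "(u \<otimes>\<^bsub>A\<^esub> u \<oplus>\<^bsub>A\<^esub> v \<otimes>\<^bsub>A\<^esub> v) \<oplus>\<^bsub>A\<^esub> (u \<otimes>\<^bsub>A\<^esub> v \<oplus>\<^bsub>A\<^esub> v \<otimes>\<^bsub>A\<^esub> u)
        = (u \<oplus>\<^bsub>A\<^esub> v) \<otimes>\<^bsub>A\<^esub> (u \<oplus>\<^bsub>A\<^esub> v)"
      using add.hyps by (simp only: prod_add_left prod_add_right M.a_ac M.a_closed prod_closed)
    finally show ?case .
  next
    case (homog u d)
    thus ?case using homogI[OF sq gr_prod] gr_carrier by blast
  qed
  define jc where "jc = (\<lambda>x y z. x \<otimes>\<^bsub>A\<^esub> (y \<otimes>\<^bsub>A\<^esub> z) \<oplus>\<^bsub>A\<^esub> y \<otimes>\<^bsub>A\<^esub> (z \<otimes>\<^bsub>A\<^esub> x) \<oplus>\<^bsub>A\<^esub> z \<otimes>\<^bsub>A\<^esub> (x \<otimes>\<^bsub>A\<^esub> y))"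
  have jc_cyc: "jc y z x = jc x y z" if "x \<in> carrier A" "y \<in> carrier A" "z \<in> carrier A" for x y z
    using that unfolding jc_def by (simp only: M.a_ac M.a_closed prod_closed)
  have jc_add: "jc (x \<oplus>\<^bsub>A\<^esub> x') y z = jc x y z \<oplus>\<^bsub>A\<^esub> jc x' y z"
    if "x \<in> carrier A" "x' \<in> carrier A" "y \<in> carrier A" "z \<in> carrier A" for x x' y z
    using that unfolding jc_def
    by (simp only: prod_add_left prod_add_right M.a_ac M.a_closed prod_closed)
  have jc_homog: "jc x y z \<in> ?J" if "x \<in> gr A d" "y \<in> gr A e" "z \<in> gr A f" for x y z d e f
  proof (rule homogI)
    show "jc x y z \<in> ?I" unfolding jc_def by (rule jac) (use that gr_carrier in auto)
    have "x \<otimes>\<^bsub>A\<^esub> (y \<otimes>\<^bsub>A\<^esub> z) \<in> gr A (d + e + f)" "y \<otimes>\<^bsub>A\<^esub> (z \<otimes>\<^bsub>A\<^esub> x) \<in> gr A (d + e + f)"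
      "z \<otimes>\<^bsub>A\<^esub> (x \<otimes>\<^bsub>A\<^esub> y) \<in> gr A (d + e + f)"
      using gr_prod[OF that(1) gr_prod[OF that(2,3)]] gr_prod[OF that(2) gr_prod[OF that(3,1)]]
        gr_prod[OF that(3) gr_prod[OF that(1,2)]] by (simp_all add: ac_simps)
    thus "jc x y z \<in> gr A (d + e + f)" unfolding jc_def by (intro gr_add)
  qed
  have J_jac: "jc x y z \<in> ?J" if "x \<in> carrier A" and y: "y \<in> carrier A" and z: "z \<in> carrier A" for x y z
    using that(1)
  proof (induction x rule: induct_homog)
    case (add u v)
    thus ?case unfolding jc_add[OF add.hyps y z] by (intro J_add)
  next
    case x: (homog x d)
    note xc = gr_carrier[OF x]
    show ?case using y
    proof (induction y rule: induct_homog)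
      case (add u v)
      have "jc (u \<oplus>\<^bsub>A\<^esub> v) z x \<in> ?J"
        unfolding jc_add[OF add.hyps z xc] using jc_cyc[OF xc _ z] add.hyps add.IH J_add by simp
      thus ?case using jc_cyc[OF xc _ z] add.hyps by simp
    next
      case y: (homog y e)
      note yc = gr_carrier[OF y]
      show ?case using z
      proof (induction z rule: induct_homog)
        case (add u v)
        have cyc: "jc w x y = jc x y w" if "w \<in> carrier A" for w
          using jc_cyc[OF that xc yc] by simp
        have "jc (u \<oplus>\<^bsub>A\<^esub> v) x y \<in> ?J"
          unfolding jc_add[OF add.hyps xc yc] using cyc add.hyps add.IH J_add by simp
        thus ?case using cyc add.hyps by simp
      next
        case (homog z f)
        thus ?case using jc_homog x y by blast
      qed
    qed
  qed
  have "lie_relators A \<subseteq> ?J"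
    using J_sq J_jac unfolding lie_relators_def jc_def by blast
  thus ?thesis by (intro homogeneous_ideal_span lie_relators_carrier) blast
qed

end

lemma lie_algebra_relators:
  assumes "lie_algebra K L"
  shows "lie_relators L \<subseteq> {\<zero>\<^bsub>L\<^esub>}"
proof -
  interpret lie_algebra K L by fact
  show ?thesis using alternating jacobi by (auto simp: lie_relators_def)
qed

context graded_lie_algebra
begin

lemma quot_graded_lie_algebra:
  assumes "algebra_ideal K L I" "homogeneous I"
  shows "graded_lie_algebra K (quot_algebra L I)"
proof -
  interpret graded_quotient K L I
    by (intro graded_quotient.intro algebra_quotient.intro graded_quotient_axioms.intro
        algebra_quotient_axioms.intro graded_nonassoc_algebra_axioms nonassoc_algebra_axioms assms)
  have "lie_relators L \<subseteq> I"
    using lie_algebra_relators[OF lie_algebra_axioms] I_closed(2) by auto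
  thus ?thesis
    by (intro graded_lie_algebra.intro Q_lie Q_graded field_axioms)
qed

end

theorem free_lie_graded_lie_algebra:
  assumes "field K"
  shows "graded_lie_algebra K (free_lie K S)"
proof -
  interpret field K by fact
  interpret A: graded_nonassoc_algebra K "free_nonassoc K S"
    by (rule free_nonassoc_graded) (rule is_cring)
  interpret graded_quotient K "free_nonassoc K S" "lie_relation_ideal K S"
    unfolding lie_relation_ideal_def
    by (intro graded_quotient.intro algebra_quotient.intro graded_quotient_axioms.intro
        algebra_quotient_axioms.intro A.graded_nonassoc_algebra_axioms A.nonassoc_algebra_axioms
        A.homogeneous_lie_relators A.ideal_span_ideal A.lie_relators_carrier)
  show ?thesis unfolding free_lie_def
    by (intro graded_lie_algebra.intro Q_lie Q_graded assms)
       (simp add: lie_relation_ideal_def A.ideal_span_superset)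
qed

lemma lie_gen_degree_one:
  assumes "field K" "i \<in> S"
  shows "lie_gen K S i \<in> gr (free_lie K S) 1"
proof -
  interpret field K by fact
  have "{t. (if t = Gen i then \<one>\<^bsub>K\<^esub> else \<zero>\<^bsub>K\<^esub>) \<noteq> \<zero>\<^bsub>K\<^esub>} = {Gen i}" by auto
  hence "(\<lambda>t. if t = Gen i then \<one>\<^bsub>K\<^esub> else \<zero>\<^bsub>K\<^esub>) \<in> gr (free_nonassoc K S) 1"
    using assms(2) by (auto simp: free_nonassoc_def free_nonassoc_carrier_def)
  thus ?thesis by (auto simp: lie_gen_def free_lie_def quot_algebra_def)
qed

theorem yang_mills_graded_lie_algebra:
  assumes "field K"
  shows "graded_lie_algebra K (yang_mills K n)"
proof -
  interpret L: graded_lie_algebra K "free_lie K {1..n}" by (rule free_lie_graded_lie_algebra[OF assms])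
  let ?L = "free_lie K {1..n}"
  let ?R = "yang_mills_relator K n ` {1..n}"
  have R: "r \<in> gr ?L 3" if r: "r \<in> ?R" for r
  proof -
    obtain j where j: "j \<in> {1..n}" "r = yang_mills_relator K n j" using r by auto
    have g: "lie_gen K {1..n} i \<in> gr ?L 1" if "i \<in> {1..n}" for i
      using lie_gen_degree_one[OF assms that] .
    have "lie_gen K {1..n} i \<otimes>\<^bsub>?L\<^esub> (lie_gen K {1..n} i \<otimes>\<^bsub>?L\<^esub> lie_gen K {1..n} j) \<in> gr ?L (1 + (1 + 1))"
      if "i \<in> {1..n}" for i
      by (rule L.gr_prod[OF g[OF that] L.gr_prod[OF g[OF that] g[OF j(1)]]])
    hence "yang_mills_relator K n j \<in> gr ?L (1 + (1 + 1))"
      unfolding yang_mills_relator_def by (intro L.gr_finsum) auto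
    thus ?thesis using j(2) by (simp add: numeral_3_eq_3)
  qed
  have Rc: "?R \<subseteq> carrier ?L" using R L.gr_carrier by blast
  have I: "algebra_ideal K ?L (ideal_span K ?L ?R)" by (rule L.ideal_span_ideal[OF Rc])
  have "L.homogeneous (ideal_span K ?L ?R)"
  proof (rule L.homogeneous_ideal_span[OF Rc])
    fix r d assume "r \<in> ?R"
    thus "L.piece r d \<in> ideal_span K ?L ?R"
      using L.piece_homog[OF R] L.ideal_span_superset[of ?R] L.algebra_idealD(2)[OF I] by auto
  qed
  thus ?thesis unfolding yang_mills_def by (rule L.quot_graded_lie_algebra[OF I])
qed

end

theory Submission
  imports Defs
begin

text \<open>
  Let \<open>\<iota>\<close> be a square root of \<open>-1\<close> in \<open>k\<close> and let \<open>z\<^sub>1, \<dots>, z\<^sub>m\<close> be the generators of \<open>\<ff>(m)\<close>.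
  Send \<open>x\<^sub>i\<close> to \<open>z\<^sub>i\<close> and \<open>x\<^bsub>i+m\<^esub>\<close> to \<open>\<iota> z\<^sub>i\<close> for \<open>1 \<le> i \<le> m\<close>, and the remaining generators to zero.
  Then \<open>\<Sum>\<^sub>i [x\<^sub>i, [x\<^sub>i, w]]\<close> is sent to \<open>\<Sum>\<^sub>i (1 + \<iota>\<^sup>2) [z\<^sub>i, [z\<^sub>i, w']] = 0\<close>, whatever \<open>w\<close> is.
\<close>

section \<open>Morphisms and quotients\<close>

text \<open>Weaker than \<open>graded_lie_hom\<close>: neither side has to be a Lie algebra or to
  satisfy the grading axioms. This covers maps out of the free nonassociative algebra, from which
  the morphisms below are obtained by passing to quotients.\<close>

locale graded_algebra_hom = A: nonassoc_algebra K A + B: nonassoc_algebra K B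
  for K (structure) and A :: "('k, 'a, 'm) graded_algebra_scheme" (structure)
    and B :: "('k, 'b, 'p) graded_algebra_scheme" (structure) +
  fixes \<phi>
  assumes hom_closed [simp]: "x \<in> carrier A \<Longrightarrow> \<phi> x \<in> carrier B"
    and hom_add: "\<lbrakk>x \<in> carrier A; y \<in> carrier A\<rbrakk> \<Longrightarrow> \<phi> (x \<oplus>\<^bsub>A\<^esub> y) = \<phi> x \<oplus>\<^bsub>B\<^esub> \<phi> y"
    and hom_smult: "\<lbrakk>a \<in> carrier K; x \<in> carrier A\<rbrakk> \<Longrightarrow> \<phi> (a \<odot>\<^bsub>A\<^esub> x) = a \<odot>\<^bsub>B\<^esub> \<phi> x"
    and hom_mult: "\<lbrakk>x \<in> carrier A; y \<in> carrier A\<rbrakk> \<Longrightarrow> \<phi> (x \<otimes>\<^bsub>A\<^esub> y) = \<phi> x \<otimes>\<^bsub>B\<^esub> \<phi> y"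
    and hom_gr: "x \<in> gr A d \<Longrightarrow> \<phi> x \<in> gr B d"

lemma (in nonassoc_algebra) prod_zero [simp]:
  assumes "x \<in> carrier A"
  shows "x \<otimes>\<^bsub>A\<^esub> \<zero>\<^bsub>A\<^esub> = \<zero>\<^bsub>A\<^esub>" "\<zero>\<^bsub>A\<^esub> \<otimes>\<^bsub>A\<^esub> x = \<zero>\<^bsub>A\<^esub>"
proof -
  show "x \<otimes>\<^bsub>A\<^esub> \<zero>\<^bsub>A\<^esub> = \<zero>\<^bsub>A\<^esub>"
    using prod_smult_right[OF R.zero_closed assms M.zero_closed] assms by simp
  show "\<zero>\<^bsub>A\<^esub> \<otimes>\<^bsub>A\<^esub> x = \<zero>\<^bsub>A\<^esub>"
    using prod_smult_left[OF R.zero_closed M.zero_closed assms] assms by simp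
qed

context graded_algebra_hom
begin

lemma hom_zero [simp]: "\<phi> \<zero>\<^bsub>A\<^esub> = \<zero>\<^bsub>B\<^esub>"
  using hom_smult[OF A.R.zero_closed A.M.zero_closed] by simp

lemma hom_uminus: "x \<in> carrier A \<Longrightarrow> \<phi> (\<ominus>\<^bsub>A\<^esub> x) = \<ominus>\<^bsub>B\<^esub> \<phi> x"
  using hom_smult[of "\<ominus>\<^bsub>K\<^esub> \<one>\<^bsub>K\<^esub>" x] by (simp add: A.smult_l_minus B.smult_l_minus)

lemma hom_finsum:
  assumes "finite D" "f \<in> D \<rightarrow> carrier A"
  shows "\<phi> (\<Oplus>\<^bsub>A\<^esub>d\<in>D. f d) = (\<Oplus>\<^bsub>B\<^esub>d\<in>D. \<phi> (f d))"
  using assms by (induction D rule: finite_induct) (auto simp: hom_add Pi_iff)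

lemma ideal_kernel: "algebra_ideal K A {x \<in> carrier A. \<phi> x = \<zero>\<^bsub>B\<^esub>}"
  by (rule A.algebra_idealI) (auto simp: hom_add hom_smult hom_mult)

lemma ideal_span_kernel:
  assumes "S \<subseteq> carrier A" "\<And>s. s \<in> S \<Longrightarrow> \<phi> s = \<zero>\<^bsub>B\<^esub>" "x \<in> ideal_span K A S"
  shows "\<phi> x = \<zero>\<^bsub>B\<^esub>"
  using A.ideal_span_minimal[OF ideal_kernel, of S] assms by auto

text \<open>The kernel of \<open>\<phi>\<close> is an ideal containing \<open>S\<close>, hence
  contains \<open>I\<close>, so \<open>\<phi>\<close> is constant on the cosets of \<open>I\<close>.
  The pieces of the quotient are the images of those of \<open>A\<close>, so degrees are preserved.
  The lemma serves twice: for the Lie relators and for the Yang-Mills relators.\<close>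

lemma quotient_lift:
  assumes "graded_nonassoc_algebra K A"
    and S: "S \<subseteq> carrier A" "\<And>s. s \<in> S \<Longrightarrow> \<phi> s = \<zero>\<^bsub>B\<^esub>"
  defines "I \<equiv> ideal_span K A S"
  obtains \<psi> where "graded_algebra_hom K (quot_algebra A I) B \<psi>"
    and "\<And>x. x \<in> carrier A \<Longrightarrow> \<psi> (I +>\<^bsub>A\<^esub> x) = \<phi> x"
proof -
  interpret G: graded_nonassoc_algebra K A by fact
  interpret Q: algebra_quotient K A I
    unfolding I_def
    by (intro algebra_quotient.intro algebra_quotient_axioms.intro
        A.nonassoc_algebra_axioms A.ideal_span_ideal S(1))
  \<comment> \<open>An arbitrary representative of the coset is chosen; the fact \<open>cls\<close>
    shows that the value does not depend on it.\<close>
  define \<psi> where "\<psi> u = \<phi> (SOME x. x \<in> carrier A \<and> u = Q.cls x)" for u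
  have cls: "\<psi> (Q.cls x) = \<phi> x" if x: "x \<in> carrier A" for x
  proof -
    define y where "y = (SOME y. y \<in> carrier A \<and> Q.cls x = Q.cls y)"
    have y: "y \<in> carrier A" "Q.cls x = Q.cls y"
      using someI[of "\<lambda>y. y \<in> carrier A \<and> Q.cls x = Q.cls y" x] x unfolding y_def by auto
    hence "x \<ominus>\<^bsub>A\<^esub> y \<in> I" using Q.cls_eq_iff[OF x y(1)] by blast
    hence "\<phi> x \<ominus>\<^bsub>B\<^esub> \<phi> y = \<zero>\<^bsub>B\<^esub>"
      using ideal_span_kernel[OF S] x y(1) unfolding I_def
      by (metis A.M.a_inv_closed a_minus_def hom_add hom_uminus)
    hence "\<phi> x = \<phi> y" using x y(1) by (metis B.M.minus_equality B.M.minus_minus B.M.a_inv_closed a_minus_def hom_closed)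
    thus ?thesis by (simp add: \<psi>_def y_def)
  qed
  have "graded_algebra_hom K Q.Q B \<psi>"
    by (intro graded_algebra_hom.intro graded_algebra_hom_axioms.intro Q.Q_nonassoc
        B.nonassoc_algebra_axioms)
       (auto elim!: Q.Q_carrierE
          simp: cls Q.Q_simps(3-6) hom_add hom_smult hom_mult hom_gr G.gr_carrier)
  thus ?thesis using cls that by blast
qed

end


section \<open>The universal property of the free nonassociative algebra\<close>

text \<open>For \<open>a\<close> equal to one, these are the basis vectors of the free
  nonassociative algebra. With the coefficient built in, a product of two monomials is again a
  monomial.\<close>

definition tree_monomial :: "('k, 'r) ring_scheme \<Rightarrow> 'x free_magma \<Rightarrow> 'k \<Rightarrow> 'x free_magma \<Rightarrow> 'k" where
  "tree_monomial K t a = (\<lambda>s. if s = t then a else \<zero>\<^bsub>K\<^esub>)"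

lemma lie_gen_eq_monomial:
  "lie_gen K S i =
     lie_relation_ideal K S +>\<^bsub>free_nonassoc K S\<^esub> tree_monomial K (Gen i) \<one>\<^bsub>K\<^esub>"
  by (simp add: lie_gen_def tree_monomial_def)

context cring
begin

lemma tree_monomial_closed:
  assumes "a \<in> carrier R" "set_free_magma t \<subseteq> S"
  shows "tree_monomial R t a \<in> carrier (free_nonassoc R S)"
proof -
  have "{s. tree_monomial R t a s \<noteq> \<zero>} \<subseteq> {t}" by (auto simp: tree_monomial_def)
  hence "finite {s. tree_monomial R t a s \<noteq> \<zero>}" using finite_subset by blast
  thus ?thesis using assms
    by (auto simp: free_nonassoc_def free_nonassoc_carrier_def tree_monomial_def)
qed

lemma tree_monomial_Br:
  assumes "a \<in> carrier R" "b \<in> carrier R"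
  shows "tree_monomial R s a \<otimes>\<^bsub>free_nonassoc R S\<^esub> tree_monomial R t b
    = tree_monomial R (Br s t) (a \<otimes> b)"
  using assms by (auto simp: free_nonassoc_def tree_monomial_def fun_eq_iff split: free_magma.splits)

lemma tree_monomial_smult:
  assumes "a \<in> carrier R"
  shows "a \<odot>\<^bsub>free_nonassoc R S\<^esub> tree_monomial R t \<one> = tree_monomial R t a"
  using assms by (auto simp: free_nonassoc_def tree_monomial_def)

text \<open>Induction on the support: one tree at a time is split off as a monomial.\<close>

lemma free_nonassoc_induct [consumes 1, case_names zero monomial_add]:
  assumes "f \<in> carrier (free_nonassoc R S)"
    and zero: "P \<zero>\<^bsub>free_nonassoc R S\<^esub>"
    and monomial_add: "\<And>a t g. \<lbrakk>a \<in> carrier R; set_free_magma t \<subseteq> S;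
      g \<in> carrier (free_nonassoc R S); P g\<rbrakk> \<Longrightarrow>
      P (tree_monomial R t a \<oplus>\<^bsub>free_nonassoc R S\<^esub> g)"
  shows "P f"
proof -
  have "P f" if "finite T" "f \<in> carrier (free_nonassoc R S)" "{t. f t \<noteq> \<zero>} \<subseteq> T" for T f
    using that
  proof (induction T arbitrary: f rule: finite_induct)
    case empty
    hence "f = \<zero>\<^bsub>free_nonassoc R S\<^esub>" by (auto simp: free_nonassoc_def)
    thus ?case using zero by simp
  next
    case (insert t T)
    have f: "\<And>s. f s \<in> carrier R" "finite {s. f s \<noteq> \<zero>}"
        "\<And>s. f s \<noteq> \<zero> \<Longrightarrow> set_free_magma s \<subseteq> S"
      using insert.prems(1) by (auto simp: free_nonassoc_def free_nonassoc_carrier_def)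
    show ?case
    proof (cases "f t = \<zero>")
      case True
      thus ?thesis using insert by blast
    next
      case False
      define g where "g = f(t := \<zero>)"
      have "{s. g s \<noteq> \<zero>} \<subseteq> {s. f s \<noteq> \<zero>}" by (auto simp: g_def)
      hence "finite {s. g s \<noteq> \<zero>}" using f(2) finite_subset by blast
      hence g: "g \<in> carrier (free_nonassoc R S)"
        using f by (auto simp: free_nonassoc_def free_nonassoc_carrier_def g_def)
      have "P g" by (rule insert.IH[OF g]) (use insert.prems in \<open>auto simp: g_def\<close>)
      hence "P (tree_monomial R t (f t) \<oplus>\<^bsub>free_nonassoc R S\<^esub> g)"
        using monomial_add[OF f(1) f(3)[OF False] g] by blast
      also have "tree_monomial R t (f t) \<oplus>\<^bsub>free_nonassoc R S\<^esub> g = f"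
        using f(1) by (auto simp: free_nonassoc_def tree_monomial_def g_def fun_eq_iff)
      finally show ?thesis .
    qed
  qed
  moreover have "finite {t. f t \<noteq> \<zero>}"
    using assms(1) by (auto simp: free_nonassoc_def free_nonassoc_carrier_def)
  ultimately show ?thesis using assms(1) by blast
qed

end

primrec tree_eval :: "('k, 'a, 'm) graded_algebra_scheme \<Rightarrow> ('x \<Rightarrow> 'a) \<Rightarrow> 'x free_magma \<Rightarrow> 'a" where
  "tree_eval B y (Gen i) = y i"
| "tree_eval B y (Br s t) = tree_eval B y s \<otimes>\<^bsub>B\<^esub> tree_eval B y t"

text \<open>The linear extension of \<open>tree_eval\<close>. Summing over the support keeps the
  index set finite; a \<open>finsum\<close> over an infinite set would be zero by
  convention.\<close>

definition free_nonassoc_lift ::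
    "('k, 'r) ring_scheme \<Rightarrow> ('k, 'a, 'm) graded_algebra_scheme \<Rightarrow> ('x \<Rightarrow> 'a)
      \<Rightarrow> ('x free_magma \<Rightarrow> 'k) \<Rightarrow> 'a" where
  "free_nonassoc_lift K B y f = (\<Oplus>\<^bsub>B\<^esub>t\<in>{t. f t \<noteq> \<zero>\<^bsub>K\<^esub>}. f t \<odot>\<^bsub>B\<^esub> tree_eval B y t)"

context graded_nonassoc_algebra
begin

lemma tree_eval_gr:
  assumes "y \<in> S \<rightarrow> gr A 1" "set_free_magma t \<subseteq> S"
  shows "tree_eval A y t \<in> gr A (leaves t)"
  using assms(2)
proof (induction t)
  case (Gen i)
  thus ?case using assms(1) by auto
next
  case (Br s t)
  thus ?case using gr_prod by simp
qed

text \<open>Bilinearity reduces multiplicativity to monomials, where it is the defining equation of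
  \<open>tree_eval\<close> at \<open>Br\<close>. As the \<open>y i\<close> have degree one, a tree
  evaluates to an element whose degree is its number of leaves.\<close>

lemma free_nonassoc_lift_hom:
  assumes y: "y \<in> S \<rightarrow> gr A 1"
  shows "graded_algebra_hom K (free_nonassoc K S) A (free_nonassoc_lift K A y)"
    and free_nonassoc_lift_Gen:
      "i \<in> S \<Longrightarrow> free_nonassoc_lift K A y (tree_monomial K (Gen i) \<one>\<^bsub>K\<^esub>) = y i"
proof -
  let ?F = "free_nonassoc K S" and ?\<phi> = "free_nonassoc_lift K A y" and ?e = "tree_eval A y"
  interpret F: nonassoc_algebra K ?F by (rule free_nonassoc_nonassoc[OF R.is_cring])
  have ec: "?e t \<in> carrier A" if "set_free_magma t \<subseteq> S" for t
    using gr_carrier[OF tree_eval_gr[OF y that]] .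
  have car: "f t \<in> carrier K" "finite {t. f t \<noteq> \<zero>\<^bsub>K\<^esub>}" "f t \<noteq> \<zero>\<^bsub>K\<^esub> \<Longrightarrow> set_free_magma t \<subseteq> S"
    if "f \<in> carrier ?F" for f t
    using that by (auto simp: free_nonassoc_def free_nonassoc_carrier_def)
  \<comment> \<open>The index set may exceed the support. This allows a common index set for
    \<open>f\<close>, \<open>g\<close> and their sum, where coefficients may cancel. The trees in
    \<open>T\<close> must have labels in \<open>S\<close> to evaluate into the carrier.\<close>
  have lift: "?\<phi> f = (\<Oplus>\<^bsub>A\<^esub>t\<in>T. f t \<odot>\<^bsub>A\<^esub> ?e t)"
    if "f \<in> carrier ?F" "finite T" "{t. f t \<noteq> \<zero>\<^bsub>K\<^esub>} \<subseteq> T" "\<And>t. t \<in> T \<Longrightarrow> set_free_magma t \<subseteq> S" for f T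
    unfolding free_nonassoc_lift_def
    by (rule add.finprod_mono_neutral_cong_left) (use that ec car[OF that(1)] in auto)
  have closed: "?\<phi> f \<in> carrier A" if "f \<in> carrier ?F" for f
    unfolding free_nonassoc_lift_def using car[OF that] ec by (intro M.finsum_closed) auto
  have add: "?\<phi> (f \<oplus>\<^bsub>?F\<^esub> g) = ?\<phi> f \<oplus>\<^bsub>A\<^esub> ?\<phi> g" if fg: "f \<in> carrier ?F" "g \<in> carrier ?F" for f g
  proof -
    let ?T = "{t. f t \<noteq> \<zero>\<^bsub>K\<^esub>} \<union> {t. g t \<noteq> \<zero>\<^bsub>K\<^esub>}"
    have T: "finite ?T" "\<And>t. t \<in> ?T \<Longrightarrow> set_free_magma t \<subseteq> S"
      using car(2,3)[OF fg(1)] car(2,3)[OF fg(2)] by blast+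
    have fgT: "(f \<oplus>\<^bsub>?F\<^esub> g) t = f t \<oplus>\<^bsub>K\<^esub> g t" for t by (simp add: free_nonassoc_def)
    have "?\<phi> (f \<oplus>\<^bsub>?F\<^esub> g) = (\<Oplus>\<^bsub>A\<^esub>t\<in>?T. (f \<oplus>\<^bsub>?F\<^esub> g) t \<odot>\<^bsub>A\<^esub> ?e t)"
      by (rule lift[OF F.M.a_closed[OF fg] T(1) _ T(2)]) (auto simp: fgT)
    also have "\<dots> = (\<Oplus>\<^bsub>A\<^esub>t\<in>?T. f t \<odot>\<^bsub>A\<^esub> ?e t \<oplus>\<^bsub>A\<^esub> g t \<odot>\<^bsub>A\<^esub> ?e t)"
      by (rule M.finsum_cong')
         (use T ec car[OF fg(1)] car[OF fg(2)] in \<open>auto simp: fgT smult_l_distr\<close>)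
    also have "\<dots> = (\<Oplus>\<^bsub>A\<^esub>t\<in>?T. f t \<odot>\<^bsub>A\<^esub> ?e t) \<oplus>\<^bsub>A\<^esub> (\<Oplus>\<^bsub>A\<^esub>t\<in>?T. g t \<odot>\<^bsub>A\<^esub> ?e t)"
      by (rule finsum_addf) (use T ec car[OF fg(1)] car[OF fg(2)] in auto)
    also have "(\<Oplus>\<^bsub>A\<^esub>t\<in>?T. f t \<odot>\<^bsub>A\<^esub> ?e t) = ?\<phi> f" using lift[OF fg(1) T(1) _ T(2)] by simp
    also have "(\<Oplus>\<^bsub>A\<^esub>t\<in>?T. g t \<odot>\<^bsub>A\<^esub> ?e t) = ?\<phi> g" using lift[OF fg(2) T(1) _ T(2)] by simp
    finally show ?thesis .
  qed
  have smult: "?\<phi> (a \<odot>\<^bsub>?F\<^esub> f) = a \<odot>\<^bsub>A\<^esub> ?\<phi> f" if a: "a \<in> carrier K" and f: "f \<in> carrier ?F" for a f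
  proof -
    let ?T = "{t. f t \<noteq> \<zero>\<^bsub>K\<^esub>}"
    have T: "finite ?T" "\<And>t. t \<in> ?T \<Longrightarrow> set_free_magma t \<subseteq> S" using car[OF f] by auto
    have aft: "(a \<odot>\<^bsub>?F\<^esub> f) t = a \<otimes>\<^bsub>K\<^esub> f t" for t by (simp add: free_nonassoc_def)
    have "?\<phi> (a \<odot>\<^bsub>?F\<^esub> f) = (\<Oplus>\<^bsub>A\<^esub>t\<in>?T. (a \<odot>\<^bsub>?F\<^esub> f) t \<odot>\<^bsub>A\<^esub> ?e t)"
      by (rule lift[OF F.smult_closed[OF a f] T(1) _ T(2)]) (use a in \<open>auto simp: aft\<close>)
    also have "\<dots> = (\<Oplus>\<^bsub>A\<^esub>t\<in>?T. a \<odot>\<^bsub>A\<^esub> (f t \<odot>\<^bsub>A\<^esub> ?e t))"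
      by (rule M.finsum_cong') (use T a ec car[OF f] in \<open>auto simp: aft smult_assoc1\<close>)
    also have "\<dots> = a \<odot>\<^bsub>A\<^esub> ?\<phi> f"
      unfolding free_nonassoc_lift_def
      by (rule finsum_smult_ldistr[symmetric]) (use T a ec car[OF f] in auto)
    finally show ?thesis .
  qed
  have mon: "?\<phi> (tree_monomial K t a) = a \<odot>\<^bsub>A\<^esub> ?e t"
    if at: "a \<in> carrier K" "set_free_magma t \<subseteq> S" for a t
  proof -
    have "?\<phi> (tree_monomial K t a) = (\<Oplus>\<^bsub>A\<^esub>s\<in>{t}. tree_monomial K t a s \<odot>\<^bsub>A\<^esub> ?e s)"
      by (rule lift[OF R.tree_monomial_closed[OF at]]) (use at in \<open>auto simp: tree_monomial_def\<close>)
    thus ?thesis using at ec by (simp add: tree_monomial_def)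
  qed
  have zero: "?\<phi> \<zero>\<^bsub>?F\<^esub> = \<zero>\<^bsub>A\<^esub>" by (simp add: free_nonassoc_lift_def free_nonassoc_def)
  have mult: "?\<phi> (f \<otimes>\<^bsub>?F\<^esub> g) = ?\<phi> f \<otimes>\<^bsub>A\<^esub> ?\<phi> g" if f: "f \<in> carrier ?F" and g: "g \<in> carrier ?F" for f g
    using f
  \<comment> \<open>The induction on \<open>f\<close> leaves a monomial as left factor; a second
    induction, on \<open>g\<close>, does the same for the right factor.\<close>
  proof (induction f rule: R.free_nonassoc_induct)
    case zero
    show ?case using g closed[OF g] \<open>?\<phi> \<zero>\<^bsub>?F\<^esub> = \<zero>\<^bsub>A\<^esub>\<close> by simp
  next
    case (monomial_add a s h)
    note s = R.tree_monomial_closed[OF monomial_add.hyps(1,2)]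
    have "?\<phi> (tree_monomial K s a \<otimes>\<^bsub>?F\<^esub> g) = ?\<phi> (tree_monomial K s a) \<otimes>\<^bsub>A\<^esub> ?\<phi> g"
      using g
    proof (induction g rule: R.free_nonassoc_induct)
      case zero
      show ?case using s closed[OF s] \<open>?\<phi> \<zero>\<^bsub>?F\<^esub> = \<zero>\<^bsub>A\<^esub>\<close> by simp
    next
      case (monomial_add b t k)
      note t = R.tree_monomial_closed[OF monomial_add.hyps(1,2)]
      have "(a \<odot>\<^bsub>A\<^esub> ?e s) \<otimes>\<^bsub>A\<^esub> (b \<odot>\<^bsub>A\<^esub> ?e t) = (a \<otimes>\<^bsub>K\<^esub> b) \<odot>\<^bsub>A\<^esub> (?e s \<otimes>\<^bsub>A\<^esub> ?e t)"
        using \<open>a \<in> carrier K\<close> \<open>set_free_magma s \<subseteq> S\<close> monomial_add.hyps(1,2) ec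
          prod_smult_left[of a "?e s" "b \<odot>\<^bsub>A\<^esub> ?e t"] prod_smult_right[of b "?e s" "?e t"]
        by (simp only: smult_assoc1 smult_closed prod_closed)
      hence "?\<phi> (tree_monomial K s a \<otimes>\<^bsub>?F\<^esub> tree_monomial K t b)
          = ?\<phi> (tree_monomial K s a) \<otimes>\<^bsub>A\<^esub> ?\<phi> (tree_monomial K t b)"
        using \<open>a \<in> carrier K\<close> \<open>set_free_magma s \<subseteq> S\<close> monomial_add.hyps(1,2) ec
        by (simp add: R.tree_monomial_Br mon)
      thus ?case using s t monomial_add.hyps(3) monomial_add.IH closed
        by (simp add: F.prod_add_right prod_add_right add)
    qed
    thus ?case using s g monomial_add.hyps(3) monomial_add.IH closed
      by (simp add: F.prod_add_left prod_add_left add)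
  qed
  have gr: "?\<phi> f \<in> gr A d" if f: "f \<in> gr ?F d" for f d
  proof -
    have fc: "f \<in> carrier ?F" "\<And>t. f t \<noteq> \<zero>\<^bsub>K\<^esub> \<Longrightarrow> leaves t = d"
      using f by (auto simp: free_nonassoc_def)
    have "f t \<odot>\<^bsub>A\<^esub> ?e t \<in> gr A d" if "f t \<noteq> \<zero>\<^bsub>K\<^esub>" for t
      using gr_smult[OF car(1)[OF fc(1)] tree_eval_gr[OF y car(3)[OF fc(1) that]]] fc(2)[OF that]
      by simp
    thus ?thesis unfolding free_nonassoc_lift_def by (intro gr_finsum car(2)[OF fc(1)]) auto
  qed
  show "graded_algebra_hom K ?F A ?\<phi>"
    by (intro graded_algebra_hom.intro graded_algebra_hom_axioms.intro F.nonassoc_algebra_axioms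
        nonassoc_algebra_axioms closed add smult mult gr)
  show "?\<phi> (tree_monomial K (Gen i) \<one>\<^bsub>K\<^esub>) = y i" if "i \<in> S"
    using mon[of "\<one>\<^bsub>K\<^esub>" "Gen i"] ec[of "Gen i"] that by simp
qed

end


section \<open>The universal property of the free Lie algebra\<close>

lemma free_lie_quotient:
  assumes "cring K"
  shows "algebra_quotient K (free_nonassoc K S) (lie_relation_ideal K S)"
proof -
  interpret F: nonassoc_algebra K "free_nonassoc K S" by (rule free_nonassoc_nonassoc[OF assms])
  show ?thesis
    unfolding lie_relation_ideal_def
    by (intro algebra_quotient.intro algebra_quotient_axioms.intro F.nonassoc_algebra_axioms
        F.ideal_span_ideal F.lie_relators_carrier)
qed

text \<open>The lift to the free nonassociative algebra sends squares and Jacobi sums to squares and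
  Jacobi sums in \<open>L\<close>, which vanish there, so it factors through the quotient.\<close>

lemma (in graded_lie_algebra) free_lie_lift:
  assumes y: "y \<in> S \<rightarrow> gr L 1"
  obtains \<phi> where "graded_algebra_hom K (free_lie K S) L \<phi>"
    and "\<And>i. i \<in> S \<Longrightarrow> \<phi> (lie_gen K S i) = y i"
proof -
  interpret h: graded_algebra_hom K "free_nonassoc K S" L "free_nonassoc_lift K L y"
    by (rule free_nonassoc_lift_hom[OF y])
  have "free_nonassoc_lift K L y r = \<zero>\<^bsub>L\<^esub>" if "r \<in> lie_relators (free_nonassoc K S)" for r
    using that unfolding lie_relators_def
    by (auto simp: h.hom_add h.hom_mult alternating jacobi)
  then obtain \<psi> where \<psi>: "graded_algebra_hom K (free_lie K S) L \<psi>"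
    "\<And>x. x \<in> carrier (free_nonassoc K S) \<Longrightarrow>
      \<psi> (lie_relation_ideal K S +>\<^bsub>free_nonassoc K S\<^esub> x) = free_nonassoc_lift K L y x"
    using h.quotient_lift[OF free_nonassoc_graded[OF R.is_cring] h.A.lie_relators_carrier]
    unfolding free_lie_def lie_relation_ideal_def by blast
  have "\<psi> (lie_gen K S i) = y i" if "i \<in> S" for i
    using that \<psi>(2)[OF R.tree_monomial_closed[of "\<one>\<^bsub>K\<^esub>" "Gen i"]] free_nonassoc_lift_Gen[OF y]
    by (simp add: lie_gen_eq_monomial)
  thus ?thesis using \<psi>(1) that by blast
qed

text \<open>The class of a tree is an iterated bracket of generators, and such classes span. The
  closure conditions on a plain set \<open>V\<close> are those that the image of a morphism
  satisfies, so this gives surjectivity once the generators are hit.\<close>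

lemma free_lie_generated:
  assumes "field K"
    and zero: "\<zero>\<^bsub>free_lie K S\<^esub> \<in> V"
    and add: "\<And>u v. \<lbrakk>u \<in> V; v \<in> V\<rbrakk> \<Longrightarrow> u \<oplus>\<^bsub>free_lie K S\<^esub> v \<in> V"
    and smult: "\<And>a u. \<lbrakk>a \<in> carrier K; u \<in> V\<rbrakk> \<Longrightarrow> a \<odot>\<^bsub>free_lie K S\<^esub> u \<in> V"
    and mult: "\<And>u v. \<lbrakk>u \<in> V; v \<in> V\<rbrakk> \<Longrightarrow> u \<otimes>\<^bsub>free_lie K S\<^esub> v \<in> V"
    and gen: "\<And>i. i \<in> S \<Longrightarrow> lie_gen K S i \<in> V"
  shows "carrier (free_lie K S) \<subseteq> V"
proof
  interpret field K by fact
  let ?F = "free_nonassoc K S"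
  interpret Q: algebra_quotient K ?F "lie_relation_ideal K S"
    by (rule free_lie_quotient) (rule is_cring)
  note simps = Q.Q_simps[folded free_lie_def]
  have tree: "Q.cls (tree_monomial K t \<one>\<^bsub>K\<^esub>) \<in> V" if "set_free_magma t \<subseteq> S" for t
    using that
  proof (induction t)
    case (Gen i)
    thus ?case using gen[of i] by (simp add: lie_gen_eq_monomial)
  next
    case (Br s t)
    hence "Q.cls (tree_monomial K s \<one>\<^bsub>K\<^esub>) \<otimes>\<^bsub>free_lie K S\<^esub> Q.cls (tree_monomial K t \<one>\<^bsub>K\<^esub>) \<in> V"
      using mult by simp
    thus ?case using Br.prems by (simp add: simps tree_monomial_closed tree_monomial_Br)
  qed
  fix u assume "u \<in> carrier (free_lie K S)"
  then obtain f where f: "f \<in> carrier ?F" "u = Q.cls f" by (auto simp: simps)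
  have "Q.cls f \<in> V" using f(1)
  proof (induction f rule: free_nonassoc_induct)
    case zero
    show ?case using assms(2) by (simp add: simps)
  next
    case (monomial_add a t g)
    note closed = tree_monomial_closed[OF _ monomial_add.hyps(2)]
    have "Q.cls (tree_monomial K t a) \<in> V"
      using smult[OF monomial_add.hyps(1) tree[OF monomial_add.hyps(2)]] monomial_add.hyps(1)
        closed[of "\<one>\<^bsub>K\<^esub>"] by (simp add: simps tree_monomial_smult)
    thus ?case using add[OF _ monomial_add.IH] closed[OF monomial_add.hyps(1)] monomial_add.hyps(3)
      by (metis simps(4))
  qed
  thus "u \<in> V" using f(2) by simp
qed


section \<open>Morphisms out of the Yang-Mills algebra\<close>

text \<open>The map \<open>\<phi>\<close> given by \<open>free_lie_lift\<close> sends the relators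
  to the sums in \<open>rel\<close>, so it descends to the quotient. The second conclusion records
  only that the \<open>y i\<close> are attained, which is enough for surjectivity and avoids naming
  the generators of the iterated quotient.\<close>

lemma (in graded_lie_algebra) yang_mills_lift:
  assumes y: "y \<in> {1..n} \<rightarrow> gr L 1"
    and rel: "\<And>j. j \<in> {1..n} \<Longrightarrow> (\<Oplus>\<^bsub>L\<^esub>i\<in>{1..n}. y i \<otimes>\<^bsub>L\<^esub> (y i \<otimes>\<^bsub>L\<^esub> y j)) = \<zero>\<^bsub>L\<^esub>"
  obtains \<phi> where "graded_algebra_hom K (yang_mills K n) L \<phi>"
    and "y ` {1..n} \<subseteq> \<phi> ` carrier (yang_mills K n)"
proof -
  note One_nat_def [simp del]
    \<comment> \<open>otherwise \<open>{1..n}\<close> becomes \<open>{Suc 0..n}\<close> and the interpreted simp rules no longer match\<close>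
  let ?F = "free_lie K {1..n}" and ?r = "yang_mills_relator K n ` {1..n}"
  let ?x = "lie_gen K {1..n}" and ?I = "ideal_span K (free_lie K {1..n}) (yang_mills_relator K n ` {1..n})"
  interpret F: graded_lie_algebra K ?F by (rule free_lie_graded_lie_algebra[OF field_axioms])
  obtain \<phi> where \<phi>: "graded_algebra_hom K ?F L \<phi>" "\<And>i. i \<in> {1..n} \<Longrightarrow> \<phi> (?x i) = y i"
    using free_lie_lift[OF y] by blast
  interpret h: graded_algebra_hom K ?F L \<phi> by fact
  have x: "?x i \<in> carrier ?F" if "i \<in> {1..n}" for i
    using F.gr_carrier[OF lie_gen_degree_one[OF field_axioms that]] .
  have yc: "y i \<in> carrier L" if "i \<in> {1..n}" for i by (rule gr_carrier[OF funcset_mem[OF y that]])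
  have r: "?r \<subseteq> carrier ?F" using x
    by (auto simp: yang_mills_relator_def intro!: F.M.finsum_closed F.prod_closed)
  have "\<phi> (yang_mills_relator K n j) = \<zero>\<^bsub>L\<^esub>" if j: "j \<in> {1..n}" for j
  proof -
    have "\<phi> (yang_mills_relator K n j) = (\<Oplus>\<^bsub>L\<^esub>i\<in>{1..n}. \<phi> (?x i \<otimes>\<^bsub>?F\<^esub> (?x i \<otimes>\<^bsub>?F\<^esub> ?x j)))"
      unfolding yang_mills_relator_def by (rule h.hom_finsum) (use x j in \<open>auto\<close>)
    also have "\<dots> = (\<Oplus>\<^bsub>L\<^esub>i\<in>{1..n}. y i \<otimes>\<^bsub>L\<^esub> (y i \<otimes>\<^bsub>L\<^esub> y j))"
      by (rule M.finsum_cong') (use x j yc \<phi>(2) in \<open>auto simp: h.hom_mult\<close>)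
    finally show ?thesis using rel[OF j] by simp
  qed
  then obtain \<psi> where \<psi>: "graded_algebra_hom K (yang_mills K n) L \<psi>"
    "\<And>x. x \<in> carrier ?F \<Longrightarrow> \<psi> (?I +>\<^bsub>?F\<^esub> x) = \<phi> x"
    using h.quotient_lift[OF F.graded_nonassoc_algebra_axioms r] unfolding yang_mills_def by blast
  interpret Q: algebra_quotient K ?F ?I
    by (intro algebra_quotient.intro algebra_quotient_axioms.intro F.nonassoc_algebra_axioms
        F.ideal_span_ideal r)
  have "y i \<in> \<psi> ` carrier (yang_mills K n)" if "i \<in> {1..n}" for i
  proof (rule image_eqI)
    show "y i = \<psi> (?I +>\<^bsub>?F\<^esub> ?x i)" using \<psi>(2)[OF x[OF that]] \<phi>(2)[OF that] by simp
    show "?I +>\<^bsub>?F\<^esub> ?x i \<in> carrier (yang_mills K n)"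
      unfolding yang_mills_def by (rule Q.cls_Q[OF x[OF that]])
  qed
  thus ?thesis using \<psi>(1) that by blast
qed

section \<open>A square root of -1\<close>

lemma (in algebraically_closed) sqrt_minus_one:
  obtains \<iota> where "\<iota> \<in> carrier L" "\<iota> \<otimes> \<iota> = \<ominus> \<one>"
proof -
  \<comment> \<open>The polynomial \<open>X^2 + 1\<close> as a coefficient list, leading coefficient
    first. It splits, so its multiset of roots has two elements and is not empty.\<close>
  let ?p = "[\<one>, \<zero>, \<one>]"
  have p: "?p \<in> carrier (poly_ring L)"
    by (simp add: univ_poly_carrier[symmetric] polynomial_def)
  hence "size (roots ?p) = 2" using roots_over_carrier[OF p] by (simp add: splitted_def)
  hence "roots ?p \<noteq> {#}" by auto
  then obtain x where "x \<in># roots ?p" by blast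
  hence x: "x \<in> carrier L" "eval ?p x = \<zero>"
    using roots_mem_iff_is_root[OF p] by (auto simp: is_root_def)
  hence "x \<otimes> x \<oplus> \<one> = \<zero>" by (simp add: numeral_2_eq_2)
  hence "x \<otimes> x = \<ominus> \<one>" using x(1) by (metis add.inv_equality m_closed one_closed minus_equality)
  thus ?thesis using x(1) that by blast
qed

section \<open>The surjection onto the free Lie algebra\<close>

theorem proposition2p1:
  fixes K :: "('k, 'r) ring_scheme" and m n :: nat
  assumes "algebraically_closed K"
    and "\<And>p::nat. p > 0 \<Longrightarrow> [p] \<cdot>\<^bsub>K\<^esub> \<one>\<^bsub>K\<^esub> \<noteq> \<zero>\<^bsub>K\<^esub>"
    and "n \<ge> 2"
    and "n \<ge> 2 * m"
  shows "\<exists>\<phi>. graded_lie_hom K (yang_mills K n) (free_lie K {1..m}) \<phi>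
           \<and> \<phi> ` carrier (yang_mills K n) = carrier (free_lie K {1..m})"
proof -
  note One_nat_def [simp del]
  interpret K: algebraically_closed K by fact
  note field = K.field_axioms
  let ?L = "free_lie K {1..m}" and ?z = "lie_gen K {1..m}"
  interpret L: graded_lie_algebra K ?L by (rule free_lie_graded_lie_algebra[OF field])
  interpret Y: graded_lie_algebra K "yang_mills K n" by (rule yang_mills_graded_lie_algebra[OF field])
  obtain \<iota> where \<iota>: "\<iota> \<in> carrier K" "\<iota> \<otimes>\<^bsub>K\<^esub> \<iota> = \<ominus>\<^bsub>K\<^esub> \<one>\<^bsub>K\<^esub>" by (rule K.sqrt_minus_one)
  \<comment> \<open>The default zero lies in every graded piece, so \<open>y i\<close> has degree
    one for all \<open>i\<close>, even outside \<open>{1..n}\<close>. In the second branch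
    \<open>i > m\<close>, so the subtraction is not truncated.\<close>
  define y where "y i = (if i \<in> {1..m} then ?z i
    else if i \<in> {m+1..2*m} then \<iota> \<odot>\<^bsub>?L\<^esub> ?z (i - m) else \<zero>\<^bsub>?L\<^esub>)" for i
  have z: "?z i \<in> gr ?L 1" if "i \<in> {1..m}" for i using lie_gen_degree_one[OF field that] .
  have zc: "?z i \<in> carrier ?L" if "i \<in> {1..m}" for i using L.gr_carrier[OF z[OF that]] .
  have y_gr: "y i \<in> gr ?L 1" for i
    unfolding y_def using \<iota>(1) L.gr_zero by (auto intro!: L.gr_smult z)
  have yc: "y i \<in> carrier ?L" for i using L.gr_carrier[OF y_gr] .
  \<comment> \<open>Proved for arbitrary \<open>w\<close>: the sum of the squares of the operators
    \<open>ad (y i)\<close> is zero. The relations are the cases where \<open>w\<close> is some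
    \<open>y j\<close>.\<close>
  have rel: "(\<Oplus>\<^bsub>?L\<^esub>i\<in>{1..n}. y i \<otimes>\<^bsub>?L\<^esub> (y i \<otimes>\<^bsub>?L\<^esub> w)) = \<zero>\<^bsub>?L\<^esub>" if w: "w \<in> carrier ?L" for w
  proof -
    let ?t = "\<lambda>i. y i \<otimes>\<^bsub>?L\<^esub> (y i \<otimes>\<^bsub>?L\<^esub> w)"
    have tc: "?t i \<in> carrier ?L" for i using yc w by simp
    \<comment> \<open>The factor \<open>\<iota>\<close> comes out of the double bracket twice, so
      the term at \<open>i + m\<close> is the negative of the term at \<open>i\<close>.\<close>
    have pair: "?t i \<oplus>\<^bsub>?L\<^esub> ?t (i + m) = \<zero>\<^bsub>?L\<^esub>" if i: "i \<in> {1..m}" for i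
    proof -
      have yi: "y i = ?z i" "y (i + m) = \<iota> \<odot>\<^bsub>?L\<^esub> ?z i" using i by (auto simp: y_def)
      have "?t (i + m) = (\<iota> \<otimes>\<^bsub>K\<^esub> \<iota>) \<odot>\<^bsub>?L\<^esub> ?t i"
        using \<iota>(1) zc[OF i] w unfolding yi
        by (simp add: L.prod_smult_left L.prod_smult_right L.smult_assoc1)
      also have "\<dots> = \<ominus>\<^bsub>?L\<^esub> ?t i" using tc[of i] \<iota>(2) by (simp add: L.smult_l_minus)
      finally show ?thesis using tc[of i] by (simp add: L.M.r_neg)
    qed
    \<comment> \<open>Indices above \<open>2 * m\<close> contribute zero. The block
      \<open>{m+1..2*m}\<close> is written as a shifted copy of \<open>{1..m}\<close>, so that
      reindexing lets the two blocks be added termwise.\<close>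
    have "(\<Oplus>\<^bsub>?L\<^esub>i\<in>{1..n}. ?t i) = (\<Oplus>\<^bsub>?L\<^esub>i\<in>{1..m} \<union> (\<lambda>i. i + m) ` {1..m}. ?t i)"
    proof (rule L.add.finprod_mono_neutral_cong_right)
      show "{1..m} \<union> (\<lambda>i. i + m) ` {1..m} \<subseteq> {1..n}" using assms(4) by auto
      show "?t i = \<zero>\<^bsub>?L\<^esub>" if "i \<in> {1..n} - ({1..m} \<union> (\<lambda>i. i + m) ` {1..m})" for i
      proof -
        have "i \<notin> {m+1..2*m}"
          using that image_eqI[of i "\<lambda>i. i + m" "i - m" "{1..m}"] by force
        hence "y i = \<zero>\<^bsub>?L\<^esub>" using that by (auto simp: y_def)
        thus ?thesis using w by simp
      qed
    qed (use tc in auto)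
    also have "\<dots> = (\<Oplus>\<^bsub>?L\<^esub>i\<in>{1..m}. ?t i) \<oplus>\<^bsub>?L\<^esub> (\<Oplus>\<^bsub>?L\<^esub>i\<in>(\<lambda>i. i + m) ` {1..m}. ?t i)"
      by (rule L.M.finsum_Un_disjoint) (use tc in auto)
    also have "(\<Oplus>\<^bsub>?L\<^esub>i\<in>(\<lambda>i. i + m) ` {1..m}. ?t i) = (\<Oplus>\<^bsub>?L\<^esub>i\<in>{1..m}. ?t (i + m))"
      by (rule L.M.finsum_reindex) (use tc in auto)
    also have "(\<Oplus>\<^bsub>?L\<^esub>i\<in>{1..m}. ?t i) \<oplus>\<^bsub>?L\<^esub> \<dots> = (\<Oplus>\<^bsub>?L\<^esub>i\<in>{1..m}. ?t i \<oplus>\<^bsub>?L\<^esub> ?t (i + m))"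
      by (rule L.M.finsum_addf[symmetric]) (use tc in auto)
    also have "\<dots> = \<zero>\<^bsub>?L\<^esub>" by (rule L.add.finprod_one_eqI) (rule pair)
    finally show ?thesis .
  qed
  obtain \<phi> where \<phi>: "graded_algebra_hom K (yang_mills K n) ?L \<phi>"
    and img: "y ` {1..n} \<subseteq> \<phi> ` carrier (yang_mills K n)"
    by (rule L.yang_mills_lift[OF funcsetI[OF y_gr] rel[OF yc]])
  interpret h: graded_algebra_hom K "yang_mills K n" ?L \<phi> by fact
  have "carrier ?L \<subseteq> \<phi> ` carrier (yang_mills K n)"
  proof (rule free_lie_generated[OF field])
    show "\<zero>\<^bsub>?L\<^esub> \<in> \<phi> ` carrier (yang_mills K n)" using h.hom_zero Y.M.zero_closed by (metis imageI)
    show "?z i \<in> \<phi> ` carrier (yang_mills K n)" if "i \<in> {1..m}" for i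
    proof -
      have "y i = ?z i" "i \<in> {1..n}" using that assms(4) by (auto simp: y_def)
      thus ?thesis using img by (metis imageI subsetD)
    qed
  \<comment> \<open>Read from right to left, the morphism laws turn a sum, scalar multiple or
    bracket of images into a single image.\<close>
  qed (auto simp flip: h.hom_add h.hom_smult h.hom_mult)
  moreover have "graded_lie_hom K (yang_mills K n) ?L \<phi>"
    by (intro graded_lie_hom.intro graded_lie_hom_axioms.intro Y.graded_lie_algebra_axioms
        L.graded_lie_algebra_axioms h.hom_closed h.hom_add h.hom_smult h.hom_mult h.hom_gr)
  ultimately show ?thesis using h.hom_closed by (intro exI[of _ \<phi>]) auto
qed

end
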